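(* Suppose that $\kappa \geq K$. Let $\{U^{(\ell)}_{h\tau}\}_{\ell \in \mathbb{N}_0} \subset \mathbb{U}_{h\tau}$ be generated by the gradient descent algorithm described below, and let $U^*_{h\tau}$ be the optimal control of problem $\mathbf{SLQ}_{h\tau}$, with optimal state $X^*_{h\tau}$. Then for $\ell=1,2,\cdots$, (i) $\| U^{(\ell)}_{h\tau}-U^*_{h\tau} \|_{\mathbb{U}_{h\tau}}^2\leq \Big(1-\frac 1 {\kappa}\Big)^{\ell}\| U^{(0)}_{h\tau}-U^*_{h\tau} \|_{\mathbb{U}_{h\tau}}^2$; (ii) $\widehat{\cal J}_{h\tau}(U^{(\ell)}_{h\tau})-\widehat{\cal J}_{h\tau}(U^*_{h\tau})\leq \frac{2 \kappa \Vert U^{(0)}_{h\tau}-U^*_{h\tau} \Vert_{\mathbb{U}_{h\tau}}^2}{\ell}$; (iii) $\max_{0 \leq n \leq N} \mathbb{E}\bigl[\|X_{h\tau}^*(t_n)-X^{(\ell)}_{h\tau}(t_n)\|_{\mathbb{L}^2}^2\bigr] +\tau \sum_{n=1}^N \mathbb{E} \bigl[\|X^*_{h\tau}(t_n)- X^{(\ell)}_{h\tau}(t_n)\|_{\mathbb{H}_0^1}^2\bigr] \leq C\Big(1-\frac 1 {\kappa}\Big)^{\ell}\| U^{(0)}_{h\tau}-U^*_{h\tau} \|_{\mathbb{U}_{h\tau}}^2$, where $C$ is independent of $h,\,\tau,\,\ell$.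
   Context: Let $D\subset\mathbb{R}^d$ be a bounded $C^2$ domain, $T>0$, $\alpha\ge 0$, $W$ a real Wiener process on a filtered probability space with its augmented natural filtration $\{\mathcal{F}_t\}$. Assume $X_0\in \mathbb{H}_0^1\cap\mathbb{H}^3$ and $\sigma\in C^1(0,T;\mathbb{H}_0^1\cap\mathbb{H}^3)$. Let $\mathbb{V}_h\subset \mathbb{H}^1_0$ be the space of continuous piecewise linear finite element functions on a regular triangulation of $D$ with mesh size $h$; $\Delta_h:\mathbb{V}_h\to\mathbb{V}_h$ the discrete Laplacian, $(-\Delta_h \xi_h,\phi_h)_{\mathbb{L}^2}=(\nabla\xi_h,\nabla\phi_h)_{\mathbb{L}^2}$; ${\cal R}_h$ the Ritz projection onto $\mathbb{V}_h$. Let $t_n=n\tau$, $\tau=T/N\le 1$, $\Delta_nW=W(t_n)-W(t_{n-1})$, and $A_0=(\mathds{1}-\tau\Delta_h)^{-1}$. Let $\mathbb{X}_{h\tau}$, $\mathbb{U}_{h\tau}$ be the spaces of adapted $\mathbb{V}_h$-valued square integrable processes that are constant on each $[t_n,t_{n+1})$, with norms $\|X\|_{\mathbb{X}_{h\tau}}^2=\tau\sum_{n=1}^N\mathbb{E}\|X(t_n)\|_{\mathbb{L}^2}^2$ and $\|U\|_{\mathbb{U}_{h\tau}}^2=\tau\sum_{n=0}^{N-1}\mathbb{E}\|U(t_n)\|_{\mathbb{L}^2}^2$. Problem $\mathbf{SLQ}_{h\tau}$: minimize ${\cal J}_\tau(X,U)=\frac12[\|X\|^2_{\mathbb{X}_{h\tau}}+\|U\|^2_{\mathbb{U}_{h\tau}}]+\frac\alpha2\mathbb{E}\|X(T)\|^2_{\mathbb{L}^2}$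 over $U\in\mathbb{U}_{h\tau}$ subject to $X(t_{n+1})-X(t_n)=\tau[\Delta_hX(t_{n+1})+U(t_n)]+[X(t_n)+{\cal R}_h\sigma(t_n)]\Delta_{n+1}W$, $n=0,\dots,N-1$, $X(0)={\cal R}_hX_0$; this problem has a unique optimal pair $(X^*_{h\tau},U^*_{h\tau})$. Denote by ${\cal S}_{h\tau}$ the control-to-state map of this difference equation and $\widehat{\cal J}_{h\tau}(U)={\cal J}_\tau({\cal S}_{h\tau}(U),U)$ the reduced functional. Define $L:\mathbb{U}_{h\tau}\to\mathbb{X}_{h\tau}$ by $(LU)(t_n)=\tau\sum_{j=0}^{n-1}A_0^{n-j}\prod_{k=j+2}^n(1+\Delta_kW)U(t_j)$, $n=1,\dots,N$, and $\widehat LU=(LU)(T)$; then $D^2\widehat{\cal J}_{h\tau}=\mathds{1}+L^*L+\alpha\widehat L^*\widehat L$ and $K:=\|\mathds{1}+L^*L+\alpha\widehat L^*\widehat L\|_{{\cal L}(\mathbb{U}_{h\tau};\mathbb{U}_{h\tau})}\le 1+\alpha Te^T+T^2e^T$ is a Lipschitz constant of $D\widehat{\cal J}_{h\tau}$. The gradient descent algorithm: given $U^{(0)}_{h\tau}\in\mathbb{U}_{h\tau}$ and $\kappa>0$, for $\ell\in\mathbb{N}_0$: (1) compute $X^{(\ell)}_{h\tau}\in\mathbb{X}_{h\tau}$ from $[\mathds{1}-\tau\Delta_h]X^{(\ell)}_{h\tau}(t_{n+1})=X^{(\ell)}_{h\tau}(t_n)+\tau U^{(\ell)}_{h\tau}(t_n)+[X^{(\ell)}_{h\tau}(t_n)+{\cal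 R}_h\sigma(t_n)]\Delta_{n+1}W$, $X^{(\ell)}_{h\tau}(0)={\cal R}_hX_0$; (2) compute $Y^{(\ell)}_{h\tau}(t_n)=-\tau\mathbb{E}\big[\sum_{j=n+1}^NA_0^{j-n}\prod_{k=n+2}^j(1+\Delta_kW)X^{(\ell)}_{h\tau}(t_j)\big|\mathcal{F}_{t_n}\big]-\alpha\mathbb{E}\big[A_0^{N-n}\prod_{k=n+2}^N(1+\Delta_kW)X^{(\ell)}_{h\tau}(T)\big|\mathcal{F}_{t_n}\big]$, $n=0,\dots,N-1$; (3) set $U^{(\ell+1)}_{h\tau}=U^{(\ell)}_{h\tau}-\frac1\kappa[U^{(\ell)}_{h\tau}-Y^{(\ell)}_{h\tau}]$. *)

theory Defs
  imports "HOL-Probability.Probability"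
begin

definition wiener_process :: "'w measure \<Rightarrow> (real \<Rightarrow> 'w \<Rightarrow> real) \<Rightarrow> bool" where
  "wiener_process M W \<longleftrightarrow>
     (\<forall>t. W t \<in> borel_measurable M) \<and>
     (\<forall>\<omega>\<in>space M. W 0 \<omega> = 0) \<and>
     (\<forall>\<omega>\<in>space M. continuous_on {0..} (\<lambda>t. W t \<omega>)) \<and>
     (\<forall>s t. 0 \<le> s \<and> s < t \<longrightarrow>
        distributed M lborel (\<lambda>\<omega>. W t \<omega> - W s \<omega>) (\<lambda>x. ennreal (normal_density 0 (sqrt (t - s)) x))) \<and>
     (\<forall>(ts :: nat \<Rightarrow> real) k. 0 \<le> ts 0 \<and> (\<forall>i<k. ts i < ts (Suc i)) \<longrightarrow>
        prob_space.indep_vars M (\<lambda>_. borel) (\<lambda>i \<omega>. W (ts (Suc i)) \<omega> - W (ts i) \<omega>) {..<k})"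

definition aug_filtration :: "'w measure \<Rightarrow> (real \<Rightarrow> 'w \<Rightarrow> real) \<Rightarrow> real \<Rightarrow> 'w measure" where
  "aug_filtration M W t =
     sigma (space M) ({W s -` B \<inter> space M | s B. 0 \<le> s \<and> s \<le> t \<and> B \<in> sets borel} \<union> null_sets M)"

definition Filt :: "'w measure \<Rightarrow> (real \<Rightarrow> 'w \<Rightarrow> real) \<Rightarrow> real \<Rightarrow> nat \<Rightarrow> 'w measure" where
  "Filt M W \<tau> n = aug_filtration M W (real n * \<tau>)"

text \<open>\<open>\<Delta>_k W = W(t_k) - W(t_{k-1})\<close>, used for \<open>k \<ge> 1\<close>.\<close>
definition dW :: "(real \<Rightarrow> 'w \<Rightarrow> real) \<Rightarrow> real \<Rightarrow> nat \<Rightarrow> 'w \<Rightarrow> real" where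
  "dW W \<tau> k \<omega> = W (real k * \<tau>) \<omega> - W (real (k - 1) * \<tau>) \<omega>"

text \<open>The ambient type \<open>'a\<close> plays the role of \<open>L^2(D)\<close> (its inner product is the \<open>L^2\<close> one);
  \<open>H\<close> plays the role of \<open>H^1_0(D)\<close> and \<open>a u v\<close> of \<open>(\<nabla>u, \<nabla>v)_{L^2}\<close>.\<close>
definition dirichlet_form :: "'a::real_inner set \<Rightarrow> ('a \<Rightarrow> 'a \<Rightarrow> real) \<Rightarrow> bool" where
  "dirichlet_form H a \<longleftrightarrow> subspace H \<and>
     (\<forall>u\<in>H. \<forall>v\<in>H. a u v = a v u) \<and>
     (\<forall>u\<in>H. \<forall>v\<in>H. \<forall>w\<in>H. \<forall>c. a (u + v) w = a u w + a v w \<and> a (c *\<^sub>R u) w = c * a u w) \<and>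
     (\<forall>u\<in>H. u \<noteq> 0 \<longrightarrow> a u u > 0)"

definition fe_space :: "'a::real_inner set \<Rightarrow> 'a set \<Rightarrow> bool" where
  "fe_space H V \<longleftrightarrow> subspace V \<and> V \<subseteq> H \<and> (\<exists>B. finite B \<and> V = span B)"

definition lapl_h :: "'a::real_inner set \<Rightarrow> ('a \<Rightarrow> 'a \<Rightarrow> real) \<Rightarrow> 'a \<Rightarrow> 'a" where
  "lapl_h V a \<xi> = (THE z. z \<in> V \<and> (\<forall>\<phi>\<in>V. inner (- z) \<phi> = a \<xi> \<phi>))"

definition A0 :: "'a::real_inner set \<Rightarrow> ('a \<Rightarrow> 'a \<Rightarrow> real) \<Rightarrow> real \<Rightarrow> 'a \<Rightarrow> 'a" where
  "A0 V a \<tau> v = (THE w. w \<in> V \<and> w - \<tau> *\<^sub>R lapl_h V a w = v)"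

definition ritz :: "'a::real_inner set \<Rightarrow> ('a \<Rightarrow> 'a \<Rightarrow> real) \<Rightarrow> 'a \<Rightarrow> 'a" where
  "ritz V a u = (THE w. w \<in> V \<and> (\<forall>\<phi>\<in>V. a w \<phi> = a u \<phi>))"

text \<open>A process in \<open>\<bbbX>_{h\<tau>}\<close> / \<open>\<bbbU>_{h\<tau>}\<close> is represented by its values \<open>X n = X(t_n)\<close>.\<close>
definition adapted_sq :: "'w measure \<Rightarrow> (real \<Rightarrow> 'w \<Rightarrow> real) \<Rightarrow> real \<Rightarrow> 'a::real_inner set \<Rightarrow> nat set
    \<Rightarrow> (nat \<Rightarrow> 'w \<Rightarrow> 'a) \<Rightarrow> bool" where
  "adapted_sq M W \<tau> V I X \<longleftrightarrow>
     (\<forall>n\<in>I. X n \<in> Filt M W \<tau> n \<rightarrow>\<^sub>M borel \<and> (\<forall>\<omega>\<in>space M. X n \<omega> \<in> V) \<and>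
            integrable M (\<lambda>\<omega>. (norm (X n \<omega>))\<^sup>2))"

definition Xspace :: "'w measure \<Rightarrow> (real \<Rightarrow> 'w \<Rightarrow> real) \<Rightarrow> real \<Rightarrow> 'a::real_inner set \<Rightarrow> nat
    \<Rightarrow> (nat \<Rightarrow> 'w \<Rightarrow> 'a) set" where
  "Xspace M W T V N = {X. adapted_sq M W (T / real N) V {0..N} X}"

definition Uspace :: "'w measure \<Rightarrow> (real \<Rightarrow> 'w \<Rightarrow> real) \<Rightarrow> real \<Rightarrow> 'a::real_inner set \<Rightarrow> nat
    \<Rightarrow> (nat \<Rightarrow> 'w \<Rightarrow> 'a) set" where
  "Uspace M W T V N = {U. adapted_sq M W (T / real N) V {0..<N} U}"

definition innerX :: "'w measure \<Rightarrow> real \<Rightarrow> nat \<Rightarrow> (nat \<Rightarrow> 'w \<Rightarrow> 'a::real_inner) \<Rightarrow> (nat \<Rightarrow> 'w \<Rightarrow> 'a) \<Rightarrow> real" where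
  "innerX M T N X Z = (T / real N) * (\<Sum>n\<in>{1..N}. integral\<^sup>L M (\<lambda>\<omega>. inner (X n \<omega>) (Z n \<omega>)))"

definition innerU :: "'w measure \<Rightarrow> real \<Rightarrow> nat \<Rightarrow> (nat \<Rightarrow> 'w \<Rightarrow> 'a::real_inner) \<Rightarrow> (nat \<Rightarrow> 'w \<Rightarrow> 'a) \<Rightarrow> real" where
  "innerU M T N U Z = (T / real N) * (\<Sum>n\<in>{0..<N}. integral\<^sup>L M (\<lambda>\<omega>. inner (U n \<omega>) (Z n \<omega>)))"

definition normX2 :: "'w measure \<Rightarrow> real \<Rightarrow> nat \<Rightarrow> (nat \<Rightarrow> 'w \<Rightarrow> 'a::real_inner) \<Rightarrow> real" where
  "normX2 M T N X = (T / real N) * (\<Sum>n\<in>{1..N}. integral\<^sup>L M (\<lambda>\<omega>. (norm (X n \<omega>))\<^sup>2))"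

definition normU2 :: "'w measure \<Rightarrow> real \<Rightarrow> nat \<Rightarrow> (nat \<Rightarrow> 'w \<Rightarrow> 'a::real_inner) \<Rightarrow> real" where
  "normU2 M T N U = (T / real N) * (\<Sum>n\<in>{0..<N}. integral\<^sup>L M (\<lambda>\<omega>. (norm (U n \<omega>))\<^sup>2))"

text \<open>\<open>[1 - \<tau>\<Delta>_h] X(t_{n+1}) = X(t_n) + \<tau> U(t_n) + [X(t_n) + R_h \<sigma>(t_n)] \<Delta>_{n+1}W\<close>, \<open>X(0) = R_h X_0\<close>.\<close>
primrec state :: "(real \<Rightarrow> 'w \<Rightarrow> real) \<Rightarrow> 'a::real_inner set \<Rightarrow> ('a \<Rightarrow> 'a \<Rightarrow> real) \<Rightarrow> real \<Rightarrow> nat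
    \<Rightarrow> 'a \<Rightarrow> (real \<Rightarrow> 'a) \<Rightarrow> (nat \<Rightarrow> 'w \<Rightarrow> 'a) \<Rightarrow> nat \<Rightarrow> 'w \<Rightarrow> 'a" where
  "state W V a T N X0 \<sigma> U 0 = (\<lambda>\<omega>. ritz V a X0)"
| "state W V a T N X0 \<sigma> U (Suc n) = (\<lambda>\<omega>.
     A0 V a (T / real N)
       (state W V a T N X0 \<sigma> U n \<omega> + (T / real N) *\<^sub>R U n \<omega>
        + dW W (T / real N) (Suc n) \<omega> *\<^sub>R (state W V a T N X0 \<sigma> U n \<omega> + ritz V a (\<sigma> (real n * (T / real N))))))"

definition Jcost :: "'w measure \<Rightarrow> real \<Rightarrow> nat \<Rightarrow> real \<Rightarrow> (nat \<Rightarrow> 'w \<Rightarrow> 'a::real_inner) \<Rightarrow> (nat \<Rightarrow> 'w \<Rightarrow> 'a) \<Rightarrow> real" where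
  "Jcost M T N \<alpha> X U = (1/2) * (normX2 M T N X + normU2 M T N U)
     + (\<alpha> / 2) * integral\<^sup>L M (\<lambda>\<omega>. (norm (X N \<omega>))\<^sup>2)"

definition Jhat :: "'w measure \<Rightarrow> (real \<Rightarrow> 'w \<Rightarrow> real) \<Rightarrow> 'a::real_inner set \<Rightarrow> ('a \<Rightarrow> 'a \<Rightarrow> real) \<Rightarrow> real \<Rightarrow> nat
    \<Rightarrow> real \<Rightarrow> 'a \<Rightarrow> (real \<Rightarrow> 'a) \<Rightarrow> (nat \<Rightarrow> 'w \<Rightarrow> 'a) \<Rightarrow> real" where
  "Jhat M W V a T N \<alpha> X0 \<sigma> U = Jcost M T N \<alpha> (state W V a T N X0 \<sigma> U) U"

definition optimal_control :: "'w measure \<Rightarrow> (real \<Rightarrow> 'w \<Rightarrow> real) \<Rightarrow> 'a::real_inner set \<Rightarrow> ('a \<Rightarrow> 'a \<Rightarrow> real)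
    \<Rightarrow> real \<Rightarrow> nat \<Rightarrow> real \<Rightarrow> 'a \<Rightarrow> (real \<Rightarrow> 'a) \<Rightarrow> (nat \<Rightarrow> 'w \<Rightarrow> 'a) \<Rightarrow> bool" where
  "optimal_control M W V a T N \<alpha> X0 \<sigma> U \<longleftrightarrow> U \<in> Uspace M W T V N \<and>
     (\<forall>U'\<in>Uspace M W T V N. Jhat M W V a T N \<alpha> X0 \<sigma> U \<le> Jhat M W V a T N \<alpha> X0 \<sigma> U')"

definition Lop :: "(real \<Rightarrow> 'w \<Rightarrow> real) \<Rightarrow> 'a::real_inner set \<Rightarrow> ('a \<Rightarrow> 'a \<Rightarrow> real) \<Rightarrow> real \<Rightarrow> nat
    \<Rightarrow> (nat \<Rightarrow> 'w \<Rightarrow> 'a) \<Rightarrow> nat \<Rightarrow> 'w \<Rightarrow> 'a" where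
  "Lop W V a T N U n \<omega> = (T / real N) *\<^sub>R
     (\<Sum>j<n. (\<Prod>k\<in>{j+2..n}. 1 + dW W (T / real N) k \<omega>) *\<^sub>R ((A0 V a (T / real N) ^^ (n - j)) (U j \<omega>)))"

definition Ladj :: "'w measure \<Rightarrow> (real \<Rightarrow> 'w \<Rightarrow> real) \<Rightarrow> 'a::real_inner set \<Rightarrow> ('a \<Rightarrow> 'a \<Rightarrow> real) \<Rightarrow> real \<Rightarrow> nat
    \<Rightarrow> (nat \<Rightarrow> 'w \<Rightarrow> 'a) \<Rightarrow> (nat \<Rightarrow> 'w \<Rightarrow> 'a)" where
  "Ladj M W V a T N X = (SOME Z. Z \<in> Uspace M W T V N \<and>
     (\<forall>U\<in>Uspace M W T V N. innerX M T N (Lop W V a T N U) X = innerU M T N U Z))"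

text \<open>Hilbert space adjoint of \<open>L^\<and> U = (L U)(T)\<close>, \<open>L^\<and> : \<bbbU>_{h\<tau>} \<rightarrow> L^2(\<Omega>, F_T; V_h)\<close>.\<close>
definition Lhat_adj :: "'w measure \<Rightarrow> (real \<Rightarrow> 'w \<Rightarrow> real) \<Rightarrow> 'a::real_inner set \<Rightarrow> ('a \<Rightarrow> 'a \<Rightarrow> real) \<Rightarrow> real \<Rightarrow> nat
    \<Rightarrow> ('w \<Rightarrow> 'a) \<Rightarrow> (nat \<Rightarrow> 'w \<Rightarrow> 'a)" where
  "Lhat_adj M W V a T N \<xi> = (SOME Z. Z \<in> Uspace M W T V N \<and>
     (\<forall>U\<in>Uspace M W T V N. integral\<^sup>L M (\<lambda>\<omega>. inner (Lop W V a T N U N \<omega>) (\<xi> \<omega>)) = innerU M T N U Z))"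

definition Hess :: "'w measure \<Rightarrow> (real \<Rightarrow> 'w \<Rightarrow> real) \<Rightarrow> 'a::real_inner set \<Rightarrow> ('a \<Rightarrow> 'a \<Rightarrow> real) \<Rightarrow> real \<Rightarrow> nat
    \<Rightarrow> real \<Rightarrow> (nat \<Rightarrow> 'w \<Rightarrow> 'a) \<Rightarrow> (nat \<Rightarrow> 'w \<Rightarrow> 'a)" where
  "Hess M W V a T N \<alpha> U = (\<lambda>n \<omega>. U n \<omega> + Ladj M W V a T N (Lop W V a T N U) n \<omega>
      + \<alpha> *\<^sub>R Lhat_adj M W V a T N (Lop W V a T N U N) n \<omega>)"

definition Kconst :: "'w measure \<Rightarrow> (real \<Rightarrow> 'w \<Rightarrow> real) \<Rightarrow> 'a::real_inner set \<Rightarrow> ('a \<Rightarrow> 'a \<Rightarrow> real) \<Rightarrow> real \<Rightarrow> nat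
    \<Rightarrow> real \<Rightarrow> real" where
  "Kconst M W V a T N \<alpha> = Sup {sqrt (normU2 M T N (Hess M W V a T N \<alpha> U)) | U.
      U \<in> Uspace M W T V N \<and> normU2 M T N U \<le> 1}"

definition onb :: "'a::real_inner set \<Rightarrow> 'a set" where
  "onb V = (SOME B. finite B \<and> B \<subseteq> V \<and> span B = V \<and> (\<forall>b\<in>B. norm b = 1) \<and>
                    (\<forall>b\<in>B. \<forall>c\<in>B. b \<noteq> c \<longrightarrow> inner b c = 0))"

definition cond_expV :: "'w measure \<Rightarrow> 'w measure \<Rightarrow> 'a::real_inner set \<Rightarrow> ('w \<Rightarrow> 'a) \<Rightarrow> 'w \<Rightarrow> 'a" where
  "cond_expV M F V f \<omega> = (\<Sum>b\<in>onb V. real_cond_exp M F (\<lambda>\<omega>'. inner (f \<omega>') b) \<omega> *\<^sub>R b)"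

definition Yadj :: "'w measure \<Rightarrow> (real \<Rightarrow> 'w \<Rightarrow> real) \<Rightarrow> 'a::real_inner set \<Rightarrow> ('a \<Rightarrow> 'a \<Rightarrow> real) \<Rightarrow> real \<Rightarrow> nat
    \<Rightarrow> real \<Rightarrow> (nat \<Rightarrow> 'w \<Rightarrow> 'a) \<Rightarrow> nat \<Rightarrow> 'w \<Rightarrow> 'a" where
  "Yadj M W V a T N \<alpha> X n \<omega> =
     - ((T / real N) *\<^sub>R cond_expV M (Filt M W (T / real N) n) V
          (\<lambda>\<omega>'. \<Sum>j\<in>{n+1..N}. (\<Prod>k\<in>{n+2..j}. 1 + dW W (T / real N) k \<omega>') *\<^sub>R
                   ((A0 V a (T / real N) ^^ (j - n)) (X j \<omega>'))) \<omega>)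
     - \<alpha> *\<^sub>R cond_expV M (Filt M W (T / real N) n) V
          (\<lambda>\<omega>'. (\<Prod>k\<in>{n+2..N}. 1 + dW W (T / real N) k \<omega>') *\<^sub>R
                   ((A0 V a (T / real N) ^^ (N - n)) (X N \<omega>'))) \<omega>"

primrec gd_iter :: "'w measure \<Rightarrow> (real \<Rightarrow> 'w \<Rightarrow> real) \<Rightarrow> 'a::real_inner set \<Rightarrow> ('a \<Rightarrow> 'a \<Rightarrow> real) \<Rightarrow> real \<Rightarrow> nat
    \<Rightarrow> real \<Rightarrow> 'a \<Rightarrow> (real \<Rightarrow> 'a) \<Rightarrow> real \<Rightarrow> (nat \<Rightarrow> 'w \<Rightarrow> 'a) \<Rightarrow> nat \<Rightarrow> (nat \<Rightarrow> 'w \<Rightarrow> 'a)" where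
  "gd_iter M W V a T N \<alpha> X0 \<sigma> \<kappa> U0 0 = U0"
| "gd_iter M W V a T N \<alpha> X0 \<sigma> \<kappa> U0 (Suc l) = (\<lambda>n \<omega>.
     gd_iter M W V a T N \<alpha> X0 \<sigma> \<kappa> U0 l n \<omega> - (1 / \<kappa>) *\<^sub>R
       (gd_iter M W V a T N \<alpha> X0 \<sigma> \<kappa> U0 l n \<omega>
        - Yadj M W V a T N \<alpha> (state W V a T N X0 \<sigma> (gd_iter M W V a T N \<alpha> X0 \<sigma> \<kappa> U0 l)) n \<omega>))"

end

theory Submission
  imports Defs
begin

text \<open>
  The state depends affinely on the control, with linear part \<open>L\<close>, so the reduced cost is a quadratic
  functional whose second derivative is the bilinear form
  \<open>B(U, Z) = (U, Z) + (LU, LZ) + \<alpha> E((LU)(T), (LZ)(T))\<close>, and \<open>B(U, U)\<close> lies between \<open>|U|^2\<close> and \<open>K |U|^2\<close>.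
  The vector \<open>g = U - Y\<close> represents the derivative: the conditional expectations in \<open>Y\<close> realise the adjoint
  of \<open>L\<close>. Since the derivative vanishes at the optimum, \<open>(g, Z) = B(d, Z)\<close> for the error \<open>d\<close>,
  and the Cauchy--Schwarz inequality for \<open>B\<close> gives \<open>|g|^2 \<le> \<kappa> B(d, d)\<close>. Hence one step decreases \<open>|d|^2\<close>
  by at least \<open>B(d, d) / \<kappa>\<close>, which gives the linear rate for the control and, because \<open>B(d, d)\<close> is itself
  nonincreasing, the rate \<open>1 / l\<close> for the cost. The state error is \<open>L d\<close>, and a discrete energy
  estimate bounds it by \<open>|d|\<close> with a constant depending on \<open>T\<close> only.
\<close>

section \<open>Discrete elliptic problems\<close>

text \<open>Two obstacles shape the work. The definition of \<open>wiener_process\<close> speaks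
  only of independent increments, not of a filtration, so independence of an increment from the
  augmented filtration has to be derived. All integrability then rests on it: a product of square
  integrable functions is in general only integrable, but a factor independent of the past costs
  nothing. The second obstacle is the encoding. \<open>lapl_h\<close>, \<open>A0\<close>,
  \<open>ritz\<close>, \<open>onb\<close>, \<open>Ladj\<close> and \<open>Lhat_adj\<close> are
  choice terms and say nothing until existence (for \<open>THE\<close> also uniqueness) is proved.
  Processes are functions and not classes, so \<open>normU2\<close> is only a seminorm and each
  division by it needs a zero case. \<open>Kconst\<close> is a \<open>Sup\<close>, an upper bound
  only once its set is known to be bounded; a crude energy bound settles this. That B(d, d) does not
  increase has its own reason: with |g|^2 = B(d, g) and B(g, g) \<le> \<kappa> |g|^2, a step lowers
  it by at least |g|^2 / \<kappa>. The constant in the state estimate does not see the mesh because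
  \<open>A0\<close> is a contraction for every V.\<close>

lemma span_linear_inj_imp_surj:
  fixes f :: "'a::real_vector \<Rightarrow> 'a"
  assumes "linear f" "finite B" "independent B" "f ` span B \<subseteq> span B"
    and inj: "\<And>v. v \<in> span B \<Longrightarrow> f v = 0 \<Longrightarrow> v = 0"
  shows "f ` span B = span B"
proof -
  have inj_on: "inj_on f (span B)"
    using inj by (simp add: linear_inj_on_iff_eq_0[OF assms(1) subspace_span])
  have ind: "independent (f ` B)"
    using linear_independent_injective_image[OF assms(1,3) inj_on] .
  have card: "card (f ` B) = card B"
    by (meson card_image inj_on inj_on_subset span_superset)
  have sub: "f ` B \<subseteq> span B"
    using assms(4) span_superset[of B] by auto
  \<comment> \<open>Counting argument: the image of B is independent, has \<open>card B\<close>
    elements and lies in \<open>span B\<close>. A vector of \<open>span B\<close> outside its span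
    would enlarge it to an independent set in \<open>span B\<close> with more than
    \<open>card B\<close> elements.\<close>
  have "span B \<subseteq> span (f ` B)"
  proof
    fix v assume v: "v \<in> span B"
    show "v \<in> span (f ` B)"
    proof (rule ccontr)
      assume nv: "v \<notin> span (f ` B)"
      then have "independent (insert v (f ` B))"
        using ind by (rule independent_insertI)
      then have "card (insert v (f ` B)) \<le> card B"
        using independent_span_bound[OF assms(2)] v sub by blast
      moreover have "v \<notin> f ` B" using nv span_base[of v "f ` B"] by auto
      ultimately show False using card assms(2) by simp
    qed
  qed
  then show ?thesis
    using assms(4) linear_span_image[OF assms(1)] by blast
qed

locale fe_setting =
  fixes H V :: "'a::{real_inner,banach,second_countable_topology} set" and a :: "'a \<Rightarrow> 'a \<Rightarrow> real"
  assumes df: "dirichlet_form H a" and fe: "fe_space H V"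
begin

lemma subspace_V: "subspace V" and V_sub_H: "V \<subseteq> H"
  using fe by (auto simp: fe_space_def)

lemma V_closed [simp]:
  "0 \<in> V" "u \<in> V \<Longrightarrow> v \<in> V \<Longrightarrow> u + v \<in> V" "u \<in> V \<Longrightarrow> v \<in> V \<Longrightarrow> u - v \<in> V"
  "u \<in> V \<Longrightarrow> c *\<^sub>R u \<in> V" "u \<in> V \<Longrightarrow> - u \<in> V"
  using subspace_V by (auto simp: subspace_def subspace_diff subspace_neg)

lemma V_sum [simp]: "(\<And>i. i \<in> I \<Longrightarrow> f i \<in> V) \<Longrightarrow> sum f I \<in> V"
  by (rule subspace_sum[OF subspace_V])

lemma form_sym: "u \<in> H \<Longrightarrow> v \<in> H \<Longrightarrow> a u v = a v u"
  and form_add: "u \<in> H \<Longrightarrow> v \<in> H \<Longrightarrow> w \<in> H \<Longrightarrow> a (u + v) w = a u w + a v w"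
  and form_scale: "u \<in> H \<Longrightarrow> w \<in> H \<Longrightarrow> a (c *\<^sub>R u) w = c * a u w"
  and form_pos: "u \<in> H \<Longrightarrow> u \<noteq> 0 \<Longrightarrow> a u u > 0"
  using df by (simp_all add: dirichlet_form_def)

lemma subspace_H: "subspace H"
  using df by (simp add: dirichlet_form_def)

lemma form_zero: "w \<in> H \<Longrightarrow> a 0 w = 0"
  using form_scale[of 0 w 0] subspace_0[OF subspace_H] by simp

lemma form_nonneg: "u \<in> H \<Longrightarrow> a u u \<ge> 0"
  using form_pos[of u] form_zero[of 0] subspace_0[OF subspace_H] by (cases "u = 0") auto

lemma form_sum:
  assumes "finite I" "\<And>i. i \<in> I \<Longrightarrow> f i \<in> H" "w \<in> H"
  shows "a (sum f I) w = (\<Sum>i\<in>I. a (f i) w)"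
  using assms(1,2)
proof (induction I rule: finite_induct)
  case (insert i I)
  then have "sum f I \<in> H"
    by (intro subspace_sum[OF subspace_H]) auto
  then show ?case
    using insert form_add[of "f i" "sum f I" w] assms(3) by simp
qed (simp add: form_zero assms)

lemma onb:
  "finite (onb V)" "onb V \<subseteq> V" "span (onb V) = V" "\<And>b. b \<in> onb V \<Longrightarrow> norm b = 1"
  "\<And>b c. b \<in> onb V \<Longrightarrow> c \<in> onb V \<Longrightarrow> b \<noteq> c \<Longrightarrow> inner b c = 0"
proof -
  obtain B where B: "finite B" "V = span B"
    using fe by (auto simp: fe_space_def)
  obtain C where C: "finite C" "span C = V" "pairwise orthogonal C"
    using basis_orthogonal[OF B(1)] B by auto
  \<comment> \<open>A pairwise orthogonal set may contain 0, which has to go before the vectors are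
    normalised.\<close>
  let ?D = "(\<lambda>x. (1 / norm x) *\<^sub>R x) ` (C - {0})"
  have "finite ?D" using C by simp
  moreover have sub: "?D \<subseteq> V"
    using span_superset[of C] C(2) by (auto intro!: span_scale)
  moreover have "span ?D = V"
  proof
    show "span ?D \<subseteq> V"
      using span_minimal[OF sub subspace_V] .
    have "x \<in> span ?D" if "x \<in> C" for x
    proof (cases "x = 0")
      case False
      then have "(1 / norm x) *\<^sub>R x \<in> span ?D"
        using that by (intro span_base) auto
      then have "norm x *\<^sub>R ((1 / norm x) *\<^sub>R x) \<in> span ?D"
        by (rule span_scale)
      then show ?thesis using False by simp
    qed (simp add: span_zero)
    then have "C \<subseteq> span ?D" by blast
    then show "V \<subseteq> span ?D"
      using span_minimal[of C "span ?D"] C(2) subspace_span by blast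
  qed
  moreover have "\<forall>b\<in>?D. norm b = 1" by auto
  moreover have "\<forall>b\<in>?D. \<forall>c\<in>?D. b \<noteq> c \<longrightarrow> inner b c = 0"
    using C(3) by (auto simp: pairwise_def orthogonal_def)
  ultimately have "\<exists>B. finite B \<and> B \<subseteq> V \<and> span B = V \<and> (\<forall>b\<in>B. norm b = 1) \<and>
      (\<forall>b\<in>B. \<forall>c\<in>B. b \<noteq> c \<longrightarrow> inner b c = 0)"
    by blast
  note * = someI_ex[OF this, folded onb_def]
  show "finite (onb V)" "onb V \<subseteq> V" "span (onb V) = V" "\<And>b. b \<in> onb V \<Longrightarrow> norm b = 1"
    "\<And>b c. b \<in> onb V \<Longrightarrow> c \<in> onb V \<Longrightarrow> b \<noteq> c \<Longrightarrow> inner b c = 0"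
    using * by auto
qed

lemma onb_V [simp]: "b \<in> onb V \<Longrightarrow> b \<in> V"
  using onb(2) by auto

lemma inner_onb: "b \<in> onb V \<Longrightarrow> c \<in> onb V \<Longrightarrow> inner b c = (if b = c then 1 else 0)"
  using onb(4,5) by (auto simp: dot_square_norm)

lemma V_eqI:
  assumes "u \<in> V" "v \<in> V" "\<And>\<phi>. \<phi> \<in> V \<Longrightarrow> inner u \<phi> = inner v \<phi>"
  shows "u = v"
proof -
  have "inner (u - v) (u - v) = 0"
    using assms(3)[of "u - v"] assms(1,2) by (simp add: inner_diff_left)
  then show ?thesis by simp
qed

lemma inner_onb_sum: "c \<in> onb V \<Longrightarrow> inner (\<Sum>b\<in>onb V. f b *\<^sub>R b) c = f c"
  using onb(1) by (simp add: inner_sum_left inner_onb if_distrib cong: if_cong)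

text \<open>The residual is orthogonal to the basis, hence to its span; as it lies in that span, it
  is orthogonal to itself.\<close>

lemma onb_expand: "v \<in> V \<Longrightarrow> v = (\<Sum>b\<in>onb V. inner v b *\<^sub>R b)"
proof -
  assume v: "v \<in> V"
  let ?w = "v - (\<Sum>b\<in>onb V. inner v b *\<^sub>R b)"
  have w: "?w \<in> V" using v by simp
  have 0: "inner ?w c = 0" if "c \<in> onb V" for c
    using inner_onb_sum[OF that, of "inner v"] by (simp add: inner_diff_left)
  have "orthogonal ?w ?w"
    using orthogonal_to_span[of ?w "onb V" ?w] w 0 onb(3) by (simp add: orthogonal_def)
  then show ?thesis by (simp add: orthogonal_def)
qed

lemma inner_expand:
  assumes "v \<in> V"
  shows "inner u v = (\<Sum>b\<in>onb V. inner u b * inner v b)"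
proof -
  have "inner u v = inner u (\<Sum>b\<in>onb V. inner v b *\<^sub>R b)"
    by (rule arg_cong[OF onb_expand[OF assms]])
  then show ?thesis by (simp add: inner_sum_right mult.commute)
qed

lemma form_expand:
  assumes "v \<in> V" "u \<in> H"
  shows "a u v = (\<Sum>b\<in>onb V. a u b * inner v b)"
proof -
  have H: "x \<in> V \<Longrightarrow> x \<in> H" for x using V_sub_H by blast
  have "a u v = a v u" using assms H form_sym by blast
  also have "\<dots> = a (\<Sum>b\<in>onb V. inner v b *\<^sub>R b) u"
    by (rule arg_cong[OF onb_expand[OF assms(1)]])
  also have "\<dots> = (\<Sum>b\<in>onb V. inner v b * a b u)"
    using onb(1) H assms(2) by (subst form_sum) (auto intro!: sum.cong simp: form_scale)
  also have "\<dots> = (\<Sum>b\<in>onb V. a u b * inner v b)"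
    using H assms(2) by (intro sum.cong) (auto simp: form_sym[of u])
  finally show ?thesis .
qed

text \<open>The Riesz representation in finite dimension, with the coefficients
  \<open>- a \<xi> b\<close> written down. It covers all of H and not only V, because the Ritz
  projection is expressed through the discrete Laplacian of a function outside V.\<close>

lemma lapl_h:
  assumes "\<xi> \<in> H"
  shows "lapl_h V a \<xi> \<in> V" "\<phi> \<in> V \<Longrightarrow> inner (lapl_h V a \<xi>) \<phi> = - a \<xi> \<phi>"
proof -
  let ?P = "\<lambda>z. z \<in> V \<and> (\<forall>\<phi>\<in>V. inner (- z) \<phi> = a \<xi> \<phi>)"
  let ?z = "\<Sum>b\<in>onb V. (- a \<xi> b) *\<^sub>R b"
  have "inner (- ?z) \<phi> = a \<xi> \<phi>" if "\<phi> \<in> V" for \<phi>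
  proof -
    have "inner ?z \<phi> = (\<Sum>b\<in>onb V. inner ?z b * inner \<phi> b)"
      by (rule inner_expand[OF that])
    also have "\<dots> = (\<Sum>b\<in>onb V. - (a \<xi> b * inner \<phi> b))"
      by (intro sum.cong refl) (simp only: inner_onb_sum mult_minus_left)
    also have "\<dots> = - a \<xi> \<phi>"
      unfolding sum_negf form_expand[OF that assms] ..
    finally show ?thesis by (simp only: inner_minus_left minus_minus)
  qed
  then have "?P ?z" by (simp del: scaleR_minus_left)
  moreover have "z = ?z" if "?P z" for z
  proof (rule V_eqI)
    fix \<phi> assume "\<phi> \<in> V"
    then have "inner (- z) \<phi> = inner (- ?z) \<phi>"
      using that \<open>?P ?z\<close> by (simp only:)
    then show "inner z \<phi> = inner ?z \<phi>"
      by (simp only: inner_minus_left neg_equal_iff_equal)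
  qed (use that \<open>?P ?z\<close> in blast)+
  ultimately have "?P (lapl_h V a \<xi>)"
    unfolding lapl_h_def by (rule theI)
  then show "lapl_h V a \<xi> \<in> V" "\<phi> \<in> V \<Longrightarrow> inner (lapl_h V a \<xi>) \<phi> = - a \<xi> \<phi>"
    by auto
qed

lemma V_H [simp]: "v \<in> V \<Longrightarrow> v \<in> H"
  using V_sub_H by blast

text \<open>Injectivity suffices in finite dimension; it follows by testing the equation with \<open>w\<close>.\<close>
lemma elliptic_solve:
  assumes "c \<ge> 0" "d \<ge> 0" "c > 0 \<or> d > 0" "v \<in> V"
  shows "\<exists>!w. w \<in> V \<and> c *\<^sub>R w - d *\<^sub>R lapl_h V a w = v"
proof -
  \<comment> \<open>The operator is extended linearly from the basis to the whole type:
    \<open>linear\<close> quantifies over all vectors, while \<open>lapl_h\<close> is characterised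
    only on H. On V the two agree by \<open>f_eq\<close>.\<close>
  define f where "f v = (\<Sum>b\<in>onb V. inner v b *\<^sub>R (c *\<^sub>R b - d *\<^sub>R lapl_h V a b))" for v
  have lin: "linear f"
    unfolding f_def by (intro linearI) (simp_all add: inner_add_left scaleR_add_left sum.distrib scaleR_sum_right)
  have fV: "f w \<in> V" for w
    unfolding f_def by (simp add: lapl_h)
  have f_eq: "f w = c *\<^sub>R w - d *\<^sub>R lapl_h V a w" if w: "w \<in> V" for w
  proof (rule V_eqI[OF fV])
    fix \<phi> assume \<phi>: "\<phi> \<in> V"
    have "inner (f w) \<phi> = (\<Sum>b\<in>onb V. inner w b * (c * inner b \<phi> + d * a \<phi> b))"
      using \<phi> by (simp add: f_def inner_sum_left inner_diff_left lapl_h form_sym[of \<phi>])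
    also have "\<dots> = c * (\<Sum>b\<in>onb V. inner \<phi> b * inner w b) + d * (\<Sum>b\<in>onb V. a \<phi> b * inner w b)"
      by (simp add: sum_distrib_left sum.distrib[symmetric] algebra_simps inner_commute)
    also have "\<dots> = c * inner w \<phi> + d * a w \<phi>"
      using \<phi> w form_expand[of w \<phi>] inner_expand[of w \<phi>] form_sym[of w \<phi>] inner_commute[of w \<phi>]
      by (simp only: V_H)
    also have "\<dots> = inner (c *\<^sub>R w - d *\<^sub>R lapl_h V a w) \<phi>"
      using \<phi> w by (simp add: inner_diff_left lapl_h)
    finally show "inner (f w) \<phi> = inner (c *\<^sub>R w - d *\<^sub>R lapl_h V a w) \<phi>" .
  qed (use w in \<open>simp add: lapl_h\<close>)
  have inj: "w = 0" if w: "w \<in> V" "f w = 0" for w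
  proof (rule ccontr)
    assume "w \<noteq> 0"
    then have pos: "inner w w > 0" "a w w > 0" using w form_pos by auto
    have "inner (f w) w = c * inner w w + d * a w w"
      unfolding f_eq[OF w(1)] using w(1) by (simp add: inner_diff_left lapl_h)
    also have "\<dots> > 0"
      using assms(1-3) pos by (auto intro: add_pos_nonneg add_nonneg_pos)
    finally show False using w(2) by simp
  qed
  have indep: "independent (onb V)"
    using onb(4)[of 0] onb(5) by (intro pairwise_orthogonal_independent) (auto simp: pairwise_def orthogonal_def)
  have "f ` V = V"
    using span_linear_inj_imp_surj[OF lin onb(1) indep, unfolded onb(3), OF _ inj] fV by blast
  then have "v \<in> f ` V" using assms(4) by simp
  then obtain w where w: "w \<in> V" "f w = v" by auto
  show ?thesis
  proof (rule ex1I[of _ w])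
    show "w \<in> V \<and> c *\<^sub>R w - d *\<^sub>R lapl_h V a w = v" using w f_eq[OF w(1)] by simp
    fix w' assume "w' \<in> V \<and> c *\<^sub>R w' - d *\<^sub>R lapl_h V a w' = v"
    then have "w' - w \<in> V" "f (w' - w) = 0"
      using w f_eq[of w'] linear_diff[OF lin, of w' w] by simp_all
    then show "w' = w" using inj[of "w' - w"] by simp
  qed
qed

lemma ritz_V [simp]:
  assumes "u \<in> H" shows "ritz V a u \<in> V"
proof -
  \<comment> \<open>The Ritz equation is the elliptic problem with coefficients 0 and 1 and
    right-hand side \<open>- lapl_h V a u\<close>; the resolvent \<open>A0\<close> is the case 1 and
    \<tau>.\<close>
  have eq: "w \<in> V \<and> (\<forall>\<phi>\<in>V. a w \<phi> = a u \<phi>) \<longleftrightarrow> w \<in> V \<and> 0 *\<^sub>R w - 1 *\<^sub>R lapl_h V a w = - lapl_h V a u" for w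
  proof (cases "w \<in> V")
    case w: True
    have "(\<forall>\<phi>\<in>V. a w \<phi> = a u \<phi>) \<longleftrightarrow> (\<forall>\<phi>\<in>V. inner (lapl_h V a w) \<phi> = inner (lapl_h V a u) \<phi>)"
      using assms w by (simp add: lapl_h)
    also have "\<dots> \<longleftrightarrow> lapl_h V a w = lapl_h V a u"
      using V_eqI[of "lapl_h V a w" "lapl_h V a u"] assms w lapl_h(1) by auto
    finally show ?thesis using w by simp
  qed simp
  have "\<exists>!w. w \<in> V \<and> (\<forall>\<phi>\<in>V. a w \<phi> = a u \<phi>)"
    unfolding eq using assms by (intro elliptic_solve) (auto simp: lapl_h)
  from theI'[OF this] show ?thesis by (simp add: ritz_def)
qed

section \<open>The resolvent of the discrete Laplacian: symmetry, contraction, measurability\<close>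

context
  fixes \<tau> :: real assumes \<tau>: "\<tau> > 0"
begin

lemma A0_V [simp]: "v \<in> V \<Longrightarrow> A0 V a \<tau> v \<in> V"
  and A0_eq: "v \<in> V \<Longrightarrow> A0 V a \<tau> v - \<tau> *\<^sub>R lapl_h V a (A0 V a \<tau> v) = v"
proof -
  assume "v \<in> V"
  then have "\<exists>!w. w \<in> V \<and> w - \<tau> *\<^sub>R lapl_h V a w = v"
    using elliptic_solve[of 1 \<tau> v] \<tau> by simp
  from theI'[OF this] show "A0 V a \<tau> v \<in> V" "A0 V a \<tau> v - \<tau> *\<^sub>R lapl_h V a (A0 V a \<tau> v) = v"
    by (simp_all add: A0_def)
qed

lemma A0_weak: "v \<in> V \<Longrightarrow> \<phi> \<in> V \<Longrightarrow> inner (A0 V a \<tau> v) \<phi> + \<tau> * a (A0 V a \<tau> v) \<phi> = inner v \<phi>"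
  using arg_cong[OF A0_eq, of v "\<lambda>u. inner u \<phi>"] by (simp add: inner_diff_left lapl_h)

text \<open>By the weak equation both sides equal the inner product of the two images plus \<tau>
  times their form. Symmetry then yields additivity and homogeneity of \<open>A0\<close>, by moving
  it to the test function.\<close>

lemma A0_sym:
  assumes "v \<in> V" "w \<in> V"
  shows "inner (A0 V a \<tau> v) w = inner v (A0 V a \<tau> w)"
  using A0_weak[of v "A0 V a \<tau> w"] A0_weak[of w "A0 V a \<tau> v"] assms
    form_sym[of "A0 V a \<tau> v" "A0 V a \<tau> w"] by (simp add: inner_commute)

lemma A0_add: "u \<in> V \<Longrightarrow> v \<in> V \<Longrightarrow> A0 V a \<tau> (u + v) = A0 V a \<tau> u + A0 V a \<tau> v"
  by (rule V_eqI) (simp_all add: A0_sym inner_add_left)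

lemma A0_scale: "u \<in> V \<Longrightarrow> A0 V a \<tau> (c *\<^sub>R u) = c *\<^sub>R A0 V a \<tau> u"
  by (rule V_eqI) (simp_all add: A0_sym)

text \<open>Implicit Euler damping: the weak equation is tested with the image of v, and the square
  of the distance between v and its image is dropped. The retained form term becomes the gradient
  part of the state estimate.\<close>

lemma A0_energy:
  assumes "v \<in> V"
  shows "(norm (A0 V a \<tau> v))\<^sup>2 + 2 * \<tau> * a (A0 V a \<tau> v) (A0 V a \<tau> v) \<le> (norm v)\<^sup>2"
proof -
  let ?w = "A0 V a \<tau> v"
  have "0 \<le> (norm (v - ?w))\<^sup>2" by simp
  also have "\<dots> = (norm v)\<^sup>2 - 2 * inner v ?w + (norm ?w)\<^sup>2"
    by (simp add: power2_norm_eq_inner inner_diff_left inner_diff_right inner_commute)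
  also have "inner v ?w = (norm ?w)\<^sup>2 + \<tau> * a ?w ?w"
    using A0_weak[of v ?w] assms by (simp add: power2_norm_eq_inner)
  finally show ?thesis by simp
qed

lemma A0_norm_le: "v \<in> V \<Longrightarrow> norm (A0 V a \<tau> v) \<le> norm v"
proof -
  assume v: "v \<in> V"
  then have "0 \<le> \<tau> * a (A0 V a \<tau> v) (A0 V a \<tau> v)"
    using \<tau> form_nonneg by simp
  with A0_energy[OF v] have "(norm (A0 V a \<tau> v))\<^sup>2 \<le> (norm v)\<^sup>2" by linarith
  then show ?thesis by (rule power2_le_imp_le) simp
qed

text \<open>A \<open>THE\<close> term offers no direct access to measurability. In coordinates,
  symmetry moves \<open>A0\<close> onto the fixed basis vectors and leaves a finite sum of inner
  products with constants.\<close>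

lemma A0_measurable:
  assumes "f \<in> borel_measurable F" "\<And>\<omega>. \<omega> \<in> space F \<Longrightarrow> f \<omega> \<in> V"
  shows "(\<lambda>\<omega>. A0 V a \<tau> (f \<omega>)) \<in> borel_measurable F"
proof -
  have "A0 V a \<tau> v = (\<Sum>b\<in>onb V. inner v (A0 V a \<tau> b) *\<^sub>R b)" if "v \<in> V" for v
  proof -
    have "A0 V a \<tau> v = (\<Sum>b\<in>onb V. inner (A0 V a \<tau> v) b *\<^sub>R b)"
      using that by (intro onb_expand) simp
    also have "\<dots> = (\<Sum>b\<in>onb V. inner v (A0 V a \<tau> b) *\<^sub>R b)"
      using that by (intro sum.cong) (simp_all add: A0_sym)
    finally show ?thesis .
  qed
  then have "(\<lambda>\<omega>. A0 V a \<tau> (f \<omega>)) \<in> borel_measurable F \<longleftrightarrow>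
      (\<lambda>\<omega>. \<Sum>b\<in>onb V. inner (f \<omega>) (A0 V a \<tau> b) *\<^sub>R b) \<in> borel_measurable F"
    using assms(2) by (intro measurable_cong) blast
  then show ?thesis using assms(1) by simp
qed

lemma A0_pow:
  assumes "v \<in> V"
  shows "(A0 V a \<tau> ^^ n) v \<in> V" "norm ((A0 V a \<tau> ^^ n) v) \<le> norm v"
proof (induction n)
  case (Suc n)
  { case 1 show ?case using Suc by simp }
  { case 2 show ?case using Suc A0_norm_le[of "(A0 V a \<tau> ^^ n) v"] by simp }
qed (use assms in auto)

lemma A0_pow_sym:
  assumes "v \<in> V" "w \<in> V"
  shows "inner ((A0 V a \<tau> ^^ n) v) w = inner v ((A0 V a \<tau> ^^ n) w)"
  using assms
proof (induction n arbitrary: w)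
  case (Suc n)
  then show ?case
    by (simp add: A0_sym A0_pow Suc.IH[of "A0 V a \<tau> w"] funpow_swap1[of "A0 V a \<tau>" n w])
qed simp

lemma A0_pow_measurable:
  assumes "f \<in> borel_measurable F" "\<And>\<omega>. \<omega> \<in> space F \<Longrightarrow> f \<omega> \<in> V"
  shows "(\<lambda>\<omega>. (A0 V a \<tau> ^^ n) (f \<omega>)) \<in> borel_measurable F"
  by (induction n) (use assms in \<open>auto intro!: A0_measurable A0_pow\<close>)

end

end

section \<open>Independence of Wiener increments from the past\<close>

locale wiener_setting = prob_space M for M :: "'w measure" +
  fixes W :: "real \<Rightarrow> 'w \<Rightarrow> real"
  assumes wiener: "wiener_process M W"
begin

lemma indep_set_mono: "indep_set A B \<Longrightarrow> A' \<subseteq> A \<Longrightarrow> B' \<subseteq> B \<Longrightarrow> indep_set A' B'"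
  unfolding indep_sets2_eq by (meson subset_eq)

lemma W_measurable [measurable]: "W t \<in> borel_measurable M"
  and W_0: "\<omega> \<in> space M \<Longrightarrow> W 0 \<omega> = 0"
  using wiener by (auto simp: wiener_process_def)

abbreviation (input) incr :: "real \<Rightarrow> real \<Rightarrow> 'w \<Rightarrow> real" where
  "incr s t \<equiv> \<lambda>\<omega>. W t \<omega> - W s \<omega>"

text \<open>Meant for finite S: finitely many times can be sorted into a grid on which independence
  of increments applies, and these \<sigma>-algebras together with the null sets form an
  intersection-stable generator of the filtration.\<close>

definition past :: "real set \<Rightarrow> 'w set set" where
  "past S = sigma_sets (space M) {W s -` B \<inter> space M | s B. s \<in> S \<and> B \<in> sets borel}"

lemma past_events: "past S \<subseteq> events"
  unfolding past_def by (rule sets.sigma_sets_subset) auto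

lemma past_Int:
  assumes "x \<in> past S" "y \<in> past S'"
  shows "x \<inter> y \<in> past (S \<union> S')"
proof -
  interpret sigma_algebra "space M" "past (S \<union> S')"
    unfolding past_def by (rule sigma_algebra_sigma_sets) auto
  have "past S \<subseteq> past (S \<union> S')" "past S' \<subseteq> past (S \<union> S')"
    unfolding past_def by (rule sigma_sets_mono'; blast)+
  with assms show ?thesis by auto
qed

lemma aug_filtration_sets:
  "sets (aug_filtration M W t) = sigma_sets (space M)
     ({W s -` B \<inter> space M | s B. 0 \<le> s \<and> s \<le> t \<and> B \<in> sets borel} \<union> null_sets M)"
  unfolding aug_filtration_def
  by (rule sets_measure_of) (auto dest: sets.sets_into_space)

lemma space_aug_filtration [simp]: "space (aug_filtration M W t) = space M"
  unfolding aug_filtration_def by (rule space_measure_of) (auto dest: sets.sets_into_space)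

lemma aug_filtration_subalgebra: "subalgebra M (aug_filtration M W t)"
proof -
  have "sets (aug_filtration M W t) \<subseteq> events"
    unfolding aug_filtration_sets by (rule sets.sigma_sets_subset) auto
  then show ?thesis by (simp add: subalgebra_def)
qed

text \<open>On the sorted grid of times, each W(s) is a sum of increments up to t, and these are
  jointly independent of the one increment from t to u.\<close>

lemma indep_finite_past_increment:
  assumes "finite S" "S \<subseteq> {0..t}" "0 \<le> t" "t < u"
  shows "indep_set (past S) (sigma_sets (space M) {incr t u -` B \<inter> space M | B. B \<in> sets borel})"
proof -
  \<comment> \<open>Inserting 0 lets the increments telescope to W itself, since W vanishes at 0.
    Inserting t makes the last grid increment, of index \<open>m - 1\<close>, run exactly from t to
    u.\<close>
  define xs where "xs = sorted_list_of_set (insert 0 (insert t S))"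
  define m where "m = length xs"
  define ts where "ts i = (if i < m then xs ! i else u)" for i
  define X where "X i = incr (ts i) (ts (Suc i))" for i
  have set_xs: "set xs = insert 0 (insert t S)" and strict: "sorted_wrt (<) xs"
    using assms(1) by (simp_all add: xs_def del: sorted_list_of_set_insert_remove)
  have srt: "sorted xs" using strict by (simp add: strict_sorted_iff)
  have m: "m > 0" using set_xs by (auto simp: m_def)
  have bounds: "0 \<le> xs ! i \<and> xs ! i \<le> t" if "i < m" for i
  proof -
    have "xs ! i \<in> set xs" using that by (simp add: m_def)
    then show ?thesis using assms(2,3) unfolding set_xs by auto
  qed
  have first: "ts 0 = 0"
  proof -
    have "0 \<in> set xs" using set_xs by simp
    then obtain i where "i < m" "xs ! i = 0" by (auto simp: in_set_conv_nth m_def)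
    then have "xs ! 0 \<le> 0" using sorted_nth_mono[OF srt, of 0 i] by (simp add: m_def)
    then show ?thesis using bounds[of 0] m by (simp add: ts_def)
  qed
  have last: "ts (m - 1) = t"
  proof -
    have "t \<in> set xs" using set_xs by simp
    then obtain i where "i < m" "xs ! i = t" by (auto simp: in_set_conv_nth m_def)
    then have "t \<le> xs ! (m - 1)" using sorted_nth_mono[OF srt, of i "m - 1"] by (simp add: m_def)
    then show ?thesis using bounds[of "m - 1"] m by (simp add: ts_def)
  qed
  have "ts i < ts (Suc i)" if "i < m" for i
  proof (cases "Suc i < m")
    case True
    then show ?thesis using sorted_wrt_nth_less[OF strict, of i "Suc i"] by (simp add: ts_def m_def)
  next
    case False
    then show ?thesis using that bounds[of i] assms(4) by (simp add: ts_def)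
  qed
  then have "indep_vars (\<lambda>_. borel) X {..<m}"
    using wiener first unfolding wiener_process_def X_def by auto
  then have ind: "indep_var (PiM {..<m - 1} (\<lambda>_. borel)) (\<lambda>\<omega>. restrict (\<lambda>i. X i \<omega>) {..<m - 1})
      (PiM {m - 1} (\<lambda>_. borel)) (\<lambda>\<omega>. restrict (\<lambda>i. X i \<omega>) {m - 1})"
    using m by (intro indep_var_restrict) auto
  have sum_X: "W (xs ! j) \<omega> = (\<Sum>i<j. X i \<omega>)" if "j < m" "\<omega> \<in> space M" for j \<omega>
  proof -
    have "(\<Sum>i<j. X i \<omega>) = W (ts j) \<omega> - W (ts 0) \<omega>"
      unfolding X_def by (rule sum_lessThan_telescope)
    then show ?thesis using that first W_0 by (simp add: ts_def)
  qed
  have past_sub: "past S \<subseteq> sigma_sets (space M) {(\<lambda>\<omega>. \<lambda>i\<in>{..<m - 1}. X i \<omega>) -` A \<inter> space M |A. A \<in> sets (PiM {..<m - 1} (\<lambda>_. borel))}"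
    unfolding past_def
  proof (rule sigma_sets_mono')
    show "{W s -` B \<inter> space M |s B. s \<in> S \<and> B \<in> sets borel} \<subseteq>
        {(\<lambda>\<omega>. \<lambda>i\<in>{..<m - 1}. X i \<omega>) -` A \<inter> space M |A. A \<in> sets (PiM {..<m - 1} (\<lambda>_. borel))}"
    proof clarify
      fix s and B :: "real set" assume "s \<in> S" and B: "B \<in> sets borel"
      then have "s \<in> set xs" by (simp add: set_xs)
      then obtain j where j: "j < m" "s = xs ! j" by (auto simp: in_set_conv_nth m_def)
      \<comment> \<open>As \<open>j < m\<close>, the sum uses only increments with index below
        \<open>m - 1\<close>, so the increment from t to u is left out even for
        \<open>s = t\<close>.\<close>
      define g where "g f = (\<Sum>i<j. f i)" for f :: "nat \<Rightarrow> real"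
      have g: "g \<in> borel_measurable (PiM {..<m - 1} (\<lambda>_. borel))"
        unfolding g_def using j by (intro borel_measurable_sum measurable_component_singleton) auto
      let ?A = "g -` B \<inter> space (PiM {..<m - 1} (\<lambda>_. borel :: real measure))"
      have "g (\<lambda>i\<in>{..<m - 1}. X i \<omega>) = (\<Sum>i<j. X i \<omega>)" for \<omega>
        unfolding g_def using j by (intro sum.cong) auto
      then have "W s -` B \<inter> space M = (\<lambda>\<omega>. \<lambda>i\<in>{..<m - 1}. X i \<omega>) -` ?A \<inter> space M"
        using j by (auto simp: sum_X space_PiM)
      moreover have "?A \<in> sets (PiM {..<m - 1} (\<lambda>_. borel))"
        using g B by (rule measurable_sets)
      ultimately show "\<exists>A. W s -` B \<inter> space M = (\<lambda>\<omega>. \<lambda>i\<in>{..<m - 1}. X i \<omega>) -` A \<inter> space M \<and> A \<in> sets (PiM {..<m - 1} (\<lambda>_. borel))"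
        by blast
    qed
  qed
  have incr_sub: "sigma_sets (space M) {incr t u -` B \<inter> space M | B. B \<in> sets borel} \<subseteq>
      sigma_sets (space M) {(\<lambda>\<omega>. \<lambda>i\<in>{m - 1}. X i \<omega>) -` A \<inter> space M |A. A \<in> sets (PiM {m - 1} (\<lambda>_. borel))}"
  proof (rule sigma_sets_mono')
    show "{incr t u -` B \<inter> space M | B. B \<in> sets borel} \<subseteq>
       {(\<lambda>\<omega>. \<lambda>i\<in>{m - 1}. X i \<omega>) -` A \<inter> space M |A. A \<in> sets (PiM {m - 1} (\<lambda>_. borel))}"
    proof clarify
      fix B :: "real set" assume B: "B \<in> sets borel"
      have "(\<lambda>f. f (m - 1)) \<in> measurable (PiM {m - 1} (\<lambda>_. borel :: real measure)) borel"
        by (rule measurable_component_singleton) simp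
      note A = measurable_sets[OF this B]
      let ?A = "(\<lambda>f. f (m - 1)) -` B \<inter> space (PiM {m - 1} (\<lambda>_. borel :: real measure))"
      have "incr t u -` B \<inter> space M = (\<lambda>\<omega>. \<lambda>i\<in>{m - 1}. X i \<omega>) -` ?A \<inter> space M"
        using m last by (auto simp: X_def space_PiM ts_def)
      then show "\<exists>A. incr t u -` B \<inter> space M = (\<lambda>\<omega>. \<lambda>i\<in>{m - 1}. X i \<omega>) -` A \<inter> space M \<and> A \<in> sets (PiM {m - 1} (\<lambda>_. borel))"
        using A by blast
    qed
  qed
  show ?thesis
    using ind unfolding indep_var_eq by (elim conjE) (rule indep_set_mono[OF _ past_sub incr_sub])
qed

text \<open>A \<pi>-system argument. Two finite pasts intersect in the past of the union of their
  time sets, and a null set meets any event in a null set, so the generator is intersection-stable.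
  On it, the product rule holds by the finite case or trivially, and it extends to the generated
  \<sigma>-algebra.\<close>

lemma indep_filtration_increment:
  assumes "0 \<le> t" "t < u"
  shows "indep_set (sets (aug_filtration M W t))
     (sigma_sets (space M) {incr t u -` B \<inter> space M | B. B \<in> sets borel})"
proof -
  define A where "A = (\<Union>S\<in>{S. finite S \<and> S \<subseteq> {0..t}}. past S) \<union> null_sets M"
  define B where "B = sigma_sets (space M) {incr t u -` B \<inter> space M | B. B \<in> sets borel}"
  have B_events: "B \<subseteq> events"
    unfolding B_def by (rule sets.sigma_sets_subset) auto
  have A_events: "A \<subseteq> events"
    using past_events by (auto simp: A_def)
  have "sets (aug_filtration M W t) \<subseteq> sigma_sets (space M) A"
    unfolding aug_filtration_sets
  proof (rule sigma_sets_mono', intro Un_least subsetI)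
    fix x assume "x \<in> {W s -` B \<inter> space M | s B. 0 \<le> s \<and> s \<le> t \<and> B \<in> sets borel}"
    then obtain s C where x: "x = W s -` C \<inter> space M" "0 \<le> s" "s \<le> t" "C \<in> sets borel" by blast
    then have "x \<in> past {s}" unfolding past_def by (intro sigma_sets.Basic) blast
    then show "x \<in> A" using x unfolding A_def by auto
  qed (simp add: A_def)
  moreover have "Int_stable A"
  proof (rule Int_stableI)
    fix x y assume xy: "x \<in> A" "y \<in> A"
    show "x \<inter> y \<in> A"
    proof (cases "x \<in> null_sets M \<or> y \<in> null_sets M")
      case True
      then have "x \<inter> y \<in> null_sets M"
        using xy A_events by (auto intro: null_set_Int1 null_set_Int2)
      then show ?thesis by (simp add: A_def)
    next
      case False
      then obtain S S' where "finite S" "S \<subseteq> {0..t}" "x \<in> past S" "finite S'" "S' \<subseteq> {0..t}" "y \<in> past S'"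
        using xy unfolding A_def by blast
      then have "x \<inter> y \<in> past (S \<union> S')" "finite (S \<union> S')" "S \<union> S' \<subseteq> {0..t}"
        by (auto intro: past_Int)
      then show ?thesis unfolding A_def by blast
    qed
  qed
  moreover have "indep_set A B"
  proof (rule indep_setI[OF A_events B_events])
    fix x y assume xy: "x \<in> A" "y \<in> B"
    show "prob (x \<inter> y) = prob x * prob y"
    proof (cases "x \<in> null_sets M")
      case True
      then have "x \<inter> y \<in> null_sets M" using xy B_events by (auto intro: null_set_Int2)
      then show ?thesis using True by (simp add: measure_eq_0_null_sets)
    next
      case False
      then obtain S where "finite S" "S \<subseteq> {0..t}" "x \<in> past S"
        using xy unfolding A_def by blast
      then show ?thesis
        using indep_setD[OF indep_finite_past_increment[OF _ _ assms]] xy(2) unfolding B_def by blast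
    qed
  qed
  moreover have "Int_stable B"
  proof (rule Int_stableI)
    interpret sigma_algebra "space M" B unfolding B_def by (rule sigma_algebra_sigma_sets) auto
    show "x \<inter> y \<in> B" if "x \<in> B" "y \<in> B" for x y using that by auto
  qed
  moreover have "sigma_sets (space M) B = B"
    unfolding B_def by (rule sigma_sets_sigma_sets_eq) auto
  ultimately have "indep_set (sigma_sets (space M) A) B" "sets (aug_filtration M W t) \<subseteq> sigma_sets (space M) A"
    using indep_set_sigma_sets[of A B] by auto
  then show ?thesis
    unfolding B_def by (rule indep_set_mono) simp
qed

lemma indep_var_increment:
  assumes "0 \<le> t" "t < u" "Z \<in> borel_measurable (aug_filtration M W t)"
  shows "indep_var borel Z borel (incr t u)"
proof -
  have "{Z -` A \<inter> space M |A. A \<in> sets borel} \<subseteq> sets (aug_filtration M W t)"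
    using measurable_sets[OF assms(3)] by auto
  then have "sigma_sets (space M) {Z -` A \<inter> space M |A. A \<in> sets borel} \<subseteq> sets (aug_filtration M W t)"
    using sets.sigma_sets_subset[of _ "aug_filtration M W t"] by simp
  from indep_set_mono[OF indep_filtration_increment[OF assms(1,2)] this subset_refl]
  show ?thesis
    using measurable_from_subalg[OF aug_filtration_subalgebra assms(3)]
    unfolding indep_var_eq by simp
qed

lemma increment_moments:
  assumes "0 \<le> s" "s < t"
  shows "integrable M (incr s t)" "expectation (incr s t) = 0"
    "integrable M (\<lambda>\<omega>. (incr s t \<omega>)\<^sup>2)" "expectation (\<lambda>\<omega>. (incr s t \<omega>)\<^sup>2) = t - s"
proof -
  have D: "distributed M lborel (incr s t) (normal_density 0 (sqrt (t - s)))"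
    using wiener assms by (auto simp: wiener_process_def)
  have pos: "sqrt (t - s) > 0" using assms by simp
  show E: "expectation (incr s t) = 0"
    by (rule normal_distributed_expectation[OF pos D])
  show "integrable M (incr s t)"
    using distributed_integrable[OF D, of "\<lambda>x. x"] integrable_normal_moment_nz_1[OF pos, of 0] by simp
  show "integrable M (\<lambda>\<omega>. (incr s t \<omega>)\<^sup>2)"
    using distributed_integrable[OF D, of "\<lambda>x. x\<^sup>2"] integrable_normal_moment[OF pos, of 0 2] by simp
  show "expectation (\<lambda>\<omega>. (incr s t \<omega>)\<^sup>2) = t - s"
    using normal_distributed_variance[OF pos D] E assms by simp
qed

text \<open>The one-step martingale property and the scalar core of the Ito isometry. Z is merely
  integrable; independence alone makes the products integrable.\<close>

lemma increment_products:
  assumes "0 \<le> t" "t < u" "Z \<in> borel_measurable (aug_filtration M W t)" "integrable M Z"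
  shows "integrable M (\<lambda>\<omega>. incr t u \<omega> * Z \<omega>)" "expectation (\<lambda>\<omega>. incr t u \<omega> * Z \<omega>) = 0"
    "integrable M (\<lambda>\<omega>. (incr t u \<omega>)\<^sup>2 * Z \<omega>)"
    "expectation (\<lambda>\<omega>. (incr t u \<omega>)\<^sup>2 * Z \<omega>) = (u - t) * expectation Z"
proof -
  note m = increment_moments[OF assms(1,2)]
  note ind = indep_var_increment[OF assms(1-3)]
  show "integrable M (\<lambda>\<omega>. incr t u \<omega> * Z \<omega>)"
    using indep_var_integrable[OF ind assms(4) m(1)] by (simp add: mult.commute)
  show "expectation (\<lambda>\<omega>. incr t u \<omega> * Z \<omega>) = 0"
    using indep_var_lebesgue_integral[OF ind assms(4) m(1)] m(2) by (simp add: mult.commute)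
  have "indep_var borel ((\<lambda>x. x) \<circ> Z) borel ((\<lambda>x. x\<^sup>2) \<circ> incr t u)"
    by (rule indep_var_compose[OF ind]) auto
  then have ind2: "indep_var borel Z borel (\<lambda>\<omega>. (incr t u \<omega>)\<^sup>2)"
    by (simp add: comp_def)
  show "integrable M (\<lambda>\<omega>. (incr t u \<omega>)\<^sup>2 * Z \<omega>)"
    using indep_var_integrable[OF ind2 assms(4) m(3)] by (simp add: mult.commute)
  show "expectation (\<lambda>\<omega>. (incr t u \<omega>)\<^sup>2 * Z \<omega>) = (u - t) * expectation Z"
    using indep_var_lebesgue_integral[OF ind2 assms(4) m(3)] m(4) by (simp add: mult.commute)
qed

end

section \<open>Square integrable discrete processes\<close>

lemma quadratic_nonneg_discriminant:
  fixes p q r :: real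
  assumes "\<And>t. 0 \<le> p + 2 * t * q + t\<^sup>2 * r" "r \<ge> 0"
  shows "q\<^sup>2 \<le> p * r"
proof (cases "r = 0")
  case True
  have "q = 0"
  proof (rule ccontr)
    assume "q \<noteq> 0"
    then have "p + 2 * (- (p + 1) / (2 * q)) * q = - 1" by (simp add: field_simps)
    then show False using assms(1)[of "- (p + 1) / (2 * q)"] True by simp
  qed
  then show ?thesis using True by simp
next
  case False
  then have r: "r > 0" using assms(2) by simp
  have "0 \<le> r * (p + 2 * (- q / r) * q + (- q / r)\<^sup>2 * r)"
    using assms(1)[of "- q / r"] r by (intro mult_nonneg_nonneg) auto
  also have "\<dots> = p * r - q\<^sup>2"
    using r by (simp add: field_simps power2_eq_square)
  finally show ?thesis by simp
qed

text \<open>Duality argument: the truncations of the conditional expectation test the bound against themselves.\<close>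
lemma (in finite_measure_subalgebra) real_cond_exp_square_integrable:
  assumes G: "integrable M G" and "c \<ge> 0"
    and bound: "\<And>Z. Z \<in> borel_measurable F \<Longrightarrow> integrable M (\<lambda>\<omega>. (Z \<omega>)\<^sup>2) \<Longrightarrow> integrable M (\<lambda>\<omega>. Z \<omega> * G \<omega>) \<Longrightarrow>
       \<bar>\<integral>\<omega>. Z \<omega> * G \<omega> \<partial>M\<bar> \<le> c * sqrt (\<integral>\<omega>. (Z \<omega>)\<^sup>2 \<partial>M)"
  shows "integrable M (\<lambda>\<omega>. (real_cond_exp M F G \<omega>)\<^sup>2)"
proof -
  define g where "g = real_cond_exp M F G"
  \<comment> \<open>Cut to zero instead of clipped, so that \<open>Z k * g\<close> equals the square
    of \<open>Z k\<close>. Boundedness of \<open>Z k\<close> makes the integral of that square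
    finite beforehand, which permits division by its root.\<close>
  define Z where "Z k \<omega> = (if \<bar>g \<omega>\<bar> \<le> real k then g \<omega> else 0)" for k \<omega>
  have [measurable]: "g \<in> borel_measurable F" "g \<in> borel_measurable M" "G \<in> borel_measurable M"
    using G by (auto simp: g_def)
  have ZF: "Z k \<in> borel_measurable F" and [measurable]: "Z k \<in> borel_measurable M" for k
    unfolding Z_def by measurable
  have Zb: "\<bar>Z k \<omega>\<bar> \<le> real k" for k \<omega>
    by (simp add: Z_def)
  have Z2: "integrable M (\<lambda>\<omega>. (Z k \<omega>)\<^sup>2)" for k
  proof (rule integrable_const_bound[where B = "(real k)\<^sup>2"])
    show "AE \<omega> in M. norm ((Z k \<omega>)\<^sup>2) \<le> (real k)\<^sup>2"
      using Zb by (intro AE_I2) (simp add: abs_le_square_iff[symmetric])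
  qed measurable
  have ZG: "integrable M (\<lambda>\<omega>. Z k \<omega> * G \<omega>)" for k
  proof (rule Bochner_Integration.integrable_bound[of _ "\<lambda>\<omega>. real k * \<bar>G \<omega>\<bar>"])
    show "AE \<omega> in M. norm (Z k \<omega> * G \<omega>) \<le> norm (real k * \<bar>G \<omega>\<bar>)"
      using Zb by (intro AE_I2) (auto simp: abs_mult intro!: mult_right_mono)
  qed (use G in auto)
  have le: "(\<integral>\<omega>. (Z k \<omega>)\<^sup>2 \<partial>M) \<le> c\<^sup>2" for k
  proof -
    let ?I = "\<integral>\<omega>. (Z k \<omega>)\<^sup>2 \<partial>M"
    have nn: "?I \<ge> 0" by simp
    have "?I = (\<integral>\<omega>. Z k \<omega> * real_cond_exp M F G \<omega> \<partial>M)"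
      by (intro Bochner_Integration.integral_cong) (auto simp: Z_def g_def power2_eq_square)
    also have "\<dots> = (\<integral>\<omega>. Z k \<omega> * G \<omega> \<partial>M)"
      by (rule real_cond_exp_intg(2)[OF ZG ZF]) measurable
    also have "\<dots> \<le> c * sqrt ?I"
      using bound[OF ZF Z2 ZG, of k] by linarith
    finally have *: "sqrt ?I * sqrt ?I \<le> c * sqrt ?I" using nn by simp
    have "sqrt ?I \<le> c"
    proof (cases "sqrt ?I = 0")
      case False
      then have "sqrt ?I > 0" using nn by (simp add: order_less_le)
      with * show ?thesis by (simp only: mult_le_cancel_right_pos)
    qed (use assms(2) in linarith)
    then have "(sqrt ?I)\<^sup>2 \<le> c\<^sup>2" by (rule power_mono) (use nn in simp)
    then show ?thesis using nn by simp
  qed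
  have "(\<integral>\<^sup>+\<omega>. ennreal ((g \<omega>)\<^sup>2) \<partial>M) \<le> (\<integral>\<^sup>+\<omega>. (SUP k. ennreal ((Z k \<omega>)\<^sup>2)) \<partial>M)"
  proof (intro nn_integral_mono)
    fix \<omega>
    obtain k :: nat where "\<bar>g \<omega>\<bar> \<le> real k" using real_arch_simple by blast
    then have "ennreal ((g \<omega>)\<^sup>2) = ennreal ((Z k \<omega>)\<^sup>2)" by (simp add: Z_def)
    then show "ennreal ((g \<omega>)\<^sup>2) \<le> (SUP k. ennreal ((Z k \<omega>)\<^sup>2))" by (auto intro: SUP_upper2)
  qed
  also have "\<dots> = (SUP k. \<integral>\<^sup>+\<omega>. ennreal ((Z k \<omega>)\<^sup>2) \<partial>M)"
  proof (rule nn_integral_monotone_convergence_SUP)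
    show "incseq (\<lambda>k \<omega>. ennreal ((Z k \<omega>)\<^sup>2))"
      by (auto simp: incseq_def le_fun_def Z_def intro!: ennreal_leI)
  qed measurable
  also have "\<dots> \<le> ennreal (c\<^sup>2)"
    using le Z2 by (intro SUP_least) (simp add: nn_integral_eq_integral ennreal_leI)
  finally have "(\<integral>\<^sup>+\<omega>. ennreal ((g \<omega>)\<^sup>2) \<partial>M) < \<infinity>"
    using order_le_less_trans by fastforce
  then show ?thesis
    unfolding g_def[symmetric] by (intro integrableI_nonneg) auto
qed

text \<open>The scalar recursion behind both rates: E is the squared control error and P the form
  B(d, d). Summing \<open>dec\<close> bounds the sum of all P by \<kappa> times \<open>E 0\<close>,
  and monotonicity makes l copies of the latest P no larger than that sum.\<close>

lemma gradient_descent_rates: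
  fixes E P :: "nat \<Rightarrow> real" and \<kappa> :: real
  assumes \<kappa>: "\<kappa> \<ge> 1" and E: "\<And>l. 0 \<le> E l" and EP: "\<And>l. E l \<le> P l"
    and dec: "\<And>l. E (Suc l) \<le> E l - P l / \<kappa>" and mono: "\<And>l. P (Suc l) \<le> P l"
  shows "E l \<le> (1 - 1 / \<kappa>) ^ l * E 0" and "real l * P l \<le> \<kappa> * E 0"
proof -
  show "E l \<le> (1 - 1 / \<kappa>) ^ l * E 0"
  proof (induction l)
    case (Suc l)
    have "E (Suc l) \<le> E l - E l / \<kappa>"
      using dec[of l] divide_right_mono[OF EP[of l], of \<kappa>] \<kappa> by linarith
    also have "\<dots> = (1 - 1 / \<kappa>) * E l" by (simp add: left_diff_distrib)
    also have "\<dots> \<le> (1 - 1 / \<kappa>) * ((1 - 1 / \<kappa>) ^ l * E 0)"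
      using Suc \<kappa> by (intro mult_left_mono) auto
    finally show ?case by simp
  qed simp
  have "(\<Sum>i<l. P i) \<le> \<kappa> * (E 0 - E l)"
  proof (induction l)
    case (Suc l)
    have "\<kappa> * (P l / \<kappa>) \<le> \<kappa> * (E l - E (Suc l))"
      using dec[of l] \<kappa> by (intro mult_left_mono) auto
    then have "P l \<le> \<kappa> * (E l - E (Suc l))" using \<kappa> by simp
    then show ?case using Suc by (simp add: right_diff_distrib)
  qed simp
  also have "\<dots> \<le> \<kappa> * E 0" using \<kappa> E[of l] by (intro mult_left_mono) auto
  finally have sum: "(\<Sum>i<l. P i) \<le> \<kappa> * E 0" .
  have "real l * P l = (\<Sum>i<l. P l)" by simp
  also have "\<dots> \<le> (\<Sum>i<l. P i)"
    using lift_Suc_antimono_le[of P, OF mono] by (intro sum_mono) auto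
  finally show "real l * P l \<le> \<kappa> * E 0" using sum by simp
qed

section \<open>The time grid and adapted square integrable V-valued functions\<close>

locale slq = fe_setting H V a + wiener_setting M W
  for H V :: "'a::{real_inner,banach,second_countable_topology} set" and a :: "'a \<Rightarrow> 'a \<Rightarrow> real"
    and M :: "'w measure" and W :: "real \<Rightarrow> 'w \<Rightarrow> real" +
  fixes T \<alpha> :: real and N :: nat and X0 :: 'a and \<sigma> :: "real \<Rightarrow> 'a"
  assumes T: "T > 0" and N: "N > 0" and step_le: "T / real N \<le> 1" and \<alpha>: "\<alpha> \<ge> 0"
    and X0: "X0 \<in> H" and \<sigma>: "\<forall>t\<in>{0..T}. \<sigma> t \<in> H"
begin

abbreviation \<tau> :: real where "\<tau> \<equiv> T / real N"
abbreviation A :: "'a \<Rightarrow> 'a" where "A \<equiv> A0 V a \<tau>"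
abbreviation F :: "nat \<Rightarrow> 'w measure" where "F \<equiv> Filt M W \<tau>"
abbreviation dw :: "nat \<Rightarrow> 'w \<Rightarrow> real" where "dw \<equiv> dW W \<tau>"
abbreviation "L \<equiv> Lop W V a T N"
abbreviation "St \<equiv> state W V a T N X0 \<sigma>"
abbreviation "\<U> \<equiv> Uspace M W T V N"

lemma \<tau>: "\<tau> > 0" using T N by simp

lemmas A_V [simp] = A0_V[OF \<tau>]
  and A_add = A0_add[OF \<tau>] and A_scale = A0_scale[OF \<tau>]
  and A_pow = A0_pow[OF \<tau>] and A_pow_sym = A0_pow_sym[OF \<tau>]

lemma A_zero: "A 0 = 0"
  using A_scale[of 0 0] by simp

lemma A_sum: "finite I \<Longrightarrow> (\<And>i. i \<in> I \<Longrightarrow> f i \<in> V) \<Longrightarrow> A (sum f I) = (\<Sum>i\<in>I. A (f i))"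
  by (induction I rule: finite_induct) (auto simp: A_add A_zero)

lemma F_space [simp]: "space (F n) = space M"
  by (simp add: Filt_def)

lemma F_subalgebra: "subalgebra M (F n)"
  by (simp add: Filt_def aug_filtration_subalgebra)

lemma F_mono: "n \<le> m \<Longrightarrow> subalgebra (F m) (F n)"
proof -
  assume "n \<le> m"
  then have "real n * \<tau> \<le> real m * \<tau>" using \<tau> by (intro mult_right_mono) auto
  then have "sets (F n) \<subseteq> sets (F m)"
    unfolding Filt_def aug_filtration_sets by (intro sigma_sets_mono') fastforce
  then show ?thesis by (simp add: subalgebra_def)
qed

lemma W_adapted: "0 \<le> s \<Longrightarrow> s \<le> t \<Longrightarrow> W s \<in> borel_measurable (aug_filtration M W t)"
  unfolding measurable_def aug_filtration_sets
  by (auto intro!: sigma_sets.Basic)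

lemma dw_eq: "dw (Suc n) \<omega> = W (real (Suc n) * \<tau>) \<omega> - W (real n * \<tau>) \<omega>"
  by (simp add: dW_def)

lemma grid: "0 \<le> real n * \<tau>" "real n * \<tau> < real (Suc n) * \<tau>" "real (Suc n) * \<tau> - real n * \<tau> = \<tau>"
  using T N by (auto simp: field_simps)

lemma dw_adapted: "dw (Suc n) \<in> borel_measurable (F (Suc n))"
proof -
  have "W (real (Suc n) * \<tau>) \<in> borel_measurable (F (Suc n))" "W (real n * \<tau>) \<in> borel_measurable (F (Suc n))"
    unfolding Filt_def using grid[of n] grid(1)[of "Suc n"] by (auto intro!: W_adapted)
  moreover have "dw (Suc n) = (\<lambda>\<omega>. W (real (Suc n) * \<tau>) \<omega> - W (real n * \<tau>) \<omega>)"
    by (rule ext) (rule dw_eq)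
  ultimately show ?thesis by simp
qed

lemma dw_measurable [measurable]: "dw k \<in> borel_measurable M"
  unfolding dW_def[abs_def] by measurable

lemma dw_products:
  assumes "Z \<in> borel_measurable (F n)" "integrable M Z"
  shows "integrable M (\<lambda>\<omega>. dw (Suc n) \<omega> * Z \<omega>)" "expectation (\<lambda>\<omega>. dw (Suc n) \<omega> * Z \<omega>) = 0"
    "integrable M (\<lambda>\<omega>. (dw (Suc n) \<omega>)\<^sup>2 * Z \<omega>)"
    "expectation (\<lambda>\<omega>. (dw (Suc n) \<omega>)\<^sup>2 * Z \<omega>) = \<tau> * expectation Z"
  using increment_products[OF grid(1,2) assms[unfolded Filt_def]] unfolding dw_eq grid(3) .

text \<open>Measurability refers to G and integrability to M: the members of the filtration are
  built with \<open>sigma\<close> and carry a \<sigma>-algebra but no probability.\<close>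

definition sqint :: "'w measure \<Rightarrow> ('w \<Rightarrow> 'a) \<Rightarrow> bool" where
  "sqint G f \<longleftrightarrow> f \<in> borel_measurable G \<and> (\<forall>\<omega>\<in>space M. f \<omega> \<in> V) \<and> integrable M (\<lambda>\<omega>. (norm (f \<omega>))\<^sup>2)"

lemma sqint_V: "sqint G f \<Longrightarrow> \<omega> \<in> space M \<Longrightarrow> f \<omega> \<in> V"
  and sqint_measurable: "sqint G f \<Longrightarrow> f \<in> borel_measurable G"
  and sqint_integrable: "sqint G f \<Longrightarrow> integrable M (\<lambda>\<omega>. (norm (f \<omega>))\<^sup>2)"
  by (simp_all add: sqint_def)

lemma sqint_subalgebra: "subalgebra G G' \<Longrightarrow> sqint G' f \<Longrightarrow> sqint G f"
  by (auto simp: sqint_def intro: measurable_from_subalg)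

lemma sqint_F_M: "sqint (F n) f \<Longrightarrow> sqint M f"
  by (rule sqint_subalgebra[OF F_subalgebra])

lemma sqint_cong:
  assumes "space G = space M" "\<And>\<omega>. \<omega> \<in> space M \<Longrightarrow> f \<omega> = g \<omega>"
  shows "sqint G f \<longleftrightarrow> sqint G g"
  using assms measurable_cong[of G f g borel]
    Bochner_Integration.integrable_cong[of M M "\<lambda>\<omega>. (norm (f \<omega>))\<^sup>2" "\<lambda>\<omega>. (norm (g \<omega>))\<^sup>2"]
  unfolding sqint_def by auto

lemma sqint_inner_integrable:
  assumes "sqint M f" "sqint M g"
  shows "integrable M (\<lambda>\<omega>. inner (f \<omega>) (g \<omega>))"
proof (rule Bochner_Integration.integrable_bound[of _ "\<lambda>\<omega>. (norm (f \<omega>))\<^sup>2 + (norm (g \<omega>))\<^sup>2"])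
  show "AE \<omega> in M. norm (inner (f \<omega>) (g \<omega>)) \<le> norm ((norm (f \<omega>))\<^sup>2 + (norm (g \<omega>))\<^sup>2)"
  proof (intro AE_I2)
    fix \<omega>
    have "\<bar>inner (f \<omega>) (g \<omega>)\<bar> \<le> norm (f \<omega>) * norm (g \<omega>)" by (rule Cauchy_Schwarz_ineq2)
    also have "\<dots> \<le> (norm (f \<omega>))\<^sup>2 + (norm (g \<omega>))\<^sup>2"
      using sum_squares_bound[of "norm (f \<omega>)" "norm (g \<omega>)"]
        mult_nonneg_nonneg[OF norm_ge_zero[of "f \<omega>"] norm_ge_zero[of "g \<omega>"]] by linarith
    finally show "norm (inner (f \<omega>) (g \<omega>)) \<le> norm ((norm (f \<omega>))\<^sup>2 + (norm (g \<omega>))\<^sup>2)" by simp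
  qed
qed (use assms in \<open>auto simp: sqint_def\<close>)

lemma sqint_dominated:
  assumes "f \<in> borel_measurable G" "subalgebra M G" "\<And>\<omega>. \<omega> \<in> space M \<Longrightarrow> f \<omega> \<in> V"
    and "integrable M h" "\<And>\<omega>. \<omega> \<in> space M \<Longrightarrow> (norm (f \<omega>))\<^sup>2 \<le> h \<omega>"
  shows "sqint G f"
  unfolding sqint_def
proof (intro conjI)
  have [measurable]: "f \<in> borel_measurable M" using assms(1,2) measurable_from_subalg by blast
  show "integrable M (\<lambda>\<omega>. (norm (f \<omega>))\<^sup>2)"
    using assms(5) by (intro Bochner_Integration.integrable_bound[OF assms(4)] AE_I2) (measurable, fastforce)
qed (use assms in auto)

lemma sqint_lincomb:
  assumes "subalgebra M G" "sqint G f" "sqint G g"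
  shows "sqint G (\<lambda>\<omega>. f \<omega> + c *\<^sub>R g \<omega>)"
proof (rule sqint_dominated[where h = "\<lambda>\<omega>. 2 * (norm (f \<omega>))\<^sup>2 + 2 * c\<^sup>2 * (norm (g \<omega>))\<^sup>2"])
  fix \<omega>
  have "(norm (f \<omega> + c *\<^sub>R g \<omega>))\<^sup>2 \<le> (norm (f \<omega>) + \<bar>c\<bar> * norm (g \<omega>))\<^sup>2"
    using norm_triangle_ineq[of "f \<omega>" "c *\<^sub>R g \<omega>"] by (intro power_mono) auto
  also have "\<dots> \<le> 2 * (norm (f \<omega>))\<^sup>2 + 2 * (\<bar>c\<bar> * norm (g \<omega>))\<^sup>2"
    using sum_squares_bound[of "norm (f \<omega>)" "\<bar>c\<bar> * norm (g \<omega>)"] by (simp add: power2_sum)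
  finally show "(norm (f \<omega> + c *\<^sub>R g \<omega>))\<^sup>2 \<le> 2 * (norm (f \<omega>))\<^sup>2 + 2 * c\<^sup>2 * (norm (g \<omega>))\<^sup>2"
    by (simp add: power_mult_distrib)
qed (use assms in \<open>auto simp: sqint_def intro!: V_closed\<close>)

lemma sqint_const: "v \<in> V \<Longrightarrow> sqint G (\<lambda>_. v)"
  by (simp add: sqint_def)

lemma sqint_add: "subalgebra M G \<Longrightarrow> sqint G f \<Longrightarrow> sqint G g \<Longrightarrow> sqint G (\<lambda>\<omega>. f \<omega> + g \<omega>)"
  using sqint_lincomb[of G f g 1] by simp

lemma sqint_scale: "subalgebra M G \<Longrightarrow> sqint G g \<Longrightarrow> sqint G (\<lambda>\<omega>. c *\<^sub>R g \<omega>)"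
  using sqint_lincomb[of G "\<lambda>_. 0" g c] by (simp add: sqint_const)

lemma sqint_sum:
  assumes "subalgebra M G" "finite I" "\<And>i. i \<in> I \<Longrightarrow> sqint G (f i)"
  shows "sqint G (\<lambda>\<omega>. \<Sum>i\<in>I. f i \<omega>)"
  using assms(2,3) by (induction I rule: finite_induct) (auto intro!: sqint_const sqint_add assms(1))

lemma sqint_A_pow:
  assumes "subalgebra M G" "sqint G f"
  shows "sqint G (\<lambda>\<omega>. (A ^^ k) (f \<omega>))"
proof (rule sqint_dominated[OF _ assms(1) _ sqint_integrable[OF assms(2)]])
  have "space G = space M" using assms(1) by (simp add: subalgebra_def)
  then show "(\<lambda>\<omega>. (A ^^ k) (f \<omega>)) \<in> borel_measurable G"
    using assms(2) by (intro A0_pow_measurable[OF \<tau>]) (auto simp: sqint_def)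
  show "\<omega> \<in> space M \<Longrightarrow> (A ^^ k) (f \<omega>) \<in> V" for \<omega>
    using assms(2) by (intro A_pow sqint_V)
  show "\<omega> \<in> space M \<Longrightarrow> (norm ((A ^^ k) (f \<omega>)))\<^sup>2 \<le> (norm (f \<omega>))\<^sup>2" for \<omega>
    using assms(2) by (intro power_mono A_pow sqint_V) auto
qed

lemma sqint_A: "subalgebra M G \<Longrightarrow> sqint G f \<Longrightarrow> sqint G (\<lambda>\<omega>. A (f \<omega>))"
  using sqint_A_pow[of G f 1] by simp

lemma sqint_Suc: "sqint (F n) f \<Longrightarrow> sqint (F (Suc n)) f"
  using sqint_subalgebra[OF F_mono[of n "Suc n"]] by simp

lemma sqint_norm_measurable: "sqint G f \<Longrightarrow> (\<lambda>\<omega>. (norm (f \<omega>))\<^sup>2) \<in> borel_measurable G"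
  using sqint_measurable[of G f] by simp

text \<open>The increment is unbounded, so square integrability of the product comes from its
  independence of the norm of f, which is measurable one step earlier.\<close>

lemma sqint_dw:
  assumes "sqint (F n) f"
  shows "sqint (F (Suc n)) (\<lambda>\<omega>. dw (Suc n) \<omega> *\<^sub>R f \<omega>)"
proof (rule sqint_dominated[OF _ F_subalgebra _ dw_products(3)[OF sqint_norm_measurable[OF assms] sqint_integrable[OF assms]]])
  have [measurable]: "f \<in> borel_measurable (F (Suc n))" "dw (Suc n) \<in> borel_measurable (F (Suc n))"
    using sqint_measurable[OF sqint_Suc[OF assms]] dw_adapted by auto
  show "(\<lambda>\<omega>. dw (Suc n) \<omega> *\<^sub>R f \<omega>) \<in> borel_measurable (F (Suc n))" by measurable
qed (use assms in \<open>auto simp: sqint_def power_mult_distrib\<close>)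

text \<open>One step of the Ito isometry: the cross term is an increment times an
  \<open>F n\<close>-measurable factor and has mean zero.\<close>

lemma expectation_norm_dw_add:
  assumes f: "sqint (F n) f" and g: "sqint (F n) g"
  shows "expectation (\<lambda>\<omega>. (norm (f \<omega> + dw (Suc n) \<omega> *\<^sub>R g \<omega>))\<^sup>2) =
    expectation (\<lambda>\<omega>. (norm (f \<omega>))\<^sup>2) + \<tau> * expectation (\<lambda>\<omega>. (norm (g \<omega>))\<^sup>2)"
proof -
  have eq: "(norm (f \<omega> + dw (Suc n) \<omega> *\<^sub>R g \<omega>))\<^sup>2 =
      (norm (f \<omega>))\<^sup>2 + dw (Suc n) \<omega> * (2 * inner (f \<omega>) (g \<omega>)) + (dw (Suc n) \<omega>)\<^sup>2 * (norm (g \<omega>))\<^sup>2" for \<omega>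
    unfolding power2_norm_eq_inner
    by (simp add: inner_add_left inner_add_right inner_commute power2_eq_square algebra_simps)
  have m: "(\<lambda>\<omega>. 2 * inner (f \<omega>) (g \<omega>)) \<in> borel_measurable (F n)"
    using sqint_measurable[OF f] sqint_measurable[OF g] by simp
  have i: "integrable M (\<lambda>\<omega>. 2 * inner (f \<omega>) (g \<omega>))"
    using sqint_inner_integrable[OF sqint_F_M[OF f] sqint_F_M[OF g]] by simp
  note p = dw_products[OF m i] dw_products[OF sqint_norm_measurable[OF g] sqint_integrable[OF g]]
  show ?thesis
    unfolding eq using p sqint_integrable[OF f] by simp
qed

section \<open>The linearised state equation\<close>

lemma Uspace_iff: "U \<in> \<U> \<longleftrightarrow> (\<forall>n<N. sqint (F n) (U n))"
  by (auto simp: Uspace_def adapted_sq_def sqint_def)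

lemma Uspace_lincomb: "U \<in> \<U> \<Longrightarrow> Z \<in> \<U> \<Longrightarrow> (\<lambda>n \<omega>. U n \<omega> + c *\<^sub>R Z n \<omega>) \<in> \<U>"
  by (auto simp: Uspace_iff intro!: sqint_lincomb F_subalgebra)

lemma Uspace_V: "U \<in> \<U> \<Longrightarrow> \<omega> \<in> space M \<Longrightarrow> n < N \<Longrightarrow> U n \<omega> \<in> V"
  by (auto simp: Uspace_iff sqint_def)

text \<open>A single kernel for L and its adjoint: the random factor is a scalar and the resolvent
  is symmetric, so it may stand on either side of the inner product. The product starts at
  \<open>j+2\<close> because the control at step j enters the next step without noise.\<close>

definition lterm :: "nat \<Rightarrow> nat \<Rightarrow> ('w \<Rightarrow> 'a) \<Rightarrow> 'w \<Rightarrow> 'a" where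
  "lterm j n f \<omega> = (\<Prod>k\<in>{j+2..n}. 1 + dw k \<omega>) *\<^sub>R (A ^^ (n - j)) (f \<omega>)"

lemma L_lterm: "L U n \<omega> = \<tau> *\<^sub>R (\<Sum>j<n. lterm j n (U j) \<omega>)"
  by (simp add: Lop_def lterm_def)

lemma lterm_V: "f \<omega> \<in> V \<Longrightarrow> lterm j n f \<omega> \<in> V"
  by (simp add: lterm_def A_pow)

lemma L_V: "(\<And>j. j < n \<Longrightarrow> U j \<omega> \<in> V) \<Longrightarrow> L U n \<omega> \<in> V"
  unfolding L_lterm by (intro V_closed V_sum lterm_V) auto

lemma L_0: "L U 0 \<omega> = 0"
  by (simp add: L_lterm)

lemma lterm_Suc:
  assumes "j < n" "f \<omega> \<in> V"
  shows "lterm j (Suc n) f \<omega> = (1 + dw (Suc n) \<omega>) *\<^sub>R A (lterm j n f \<omega>)"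
proof -
  have "{j+2..Suc n} = insert (Suc n) {j+2..n}" using assms(1) by auto
  then have "(\<Prod>k\<in>{j+2..Suc n}. 1 + dw k \<omega>) = (1 + dw (Suc n) \<omega>) * (\<Prod>k\<in>{j+2..n}. 1 + dw k \<omega>)" by simp
  moreover have "(A ^^ (Suc n - j)) (f \<omega>) = A ((A ^^ (n - j)) (f \<omega>))"
    using assms(1) by (simp add: Suc_diff_le)
  ultimately show ?thesis
    using assms(2) by (simp only: lterm_def A_scale A_pow scaleR_scaleR)
qed

text \<open>From n to n+1 each old summand gains one factor \<open>1 + dw (Suc n)\<close> and one
  resolvent, while the new summand has an empty product. Adaptedness and the energy estimate are
  proved by induction over this recursion instead of the explicit sum.\<close>

lemma L_Suc:
  assumes "\<And>j. j \<le> n \<Longrightarrow> U j \<omega> \<in> V"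
  shows "L U (Suc n) \<omega> = A ((L U n \<omega> + \<tau> *\<^sub>R U n \<omega>) + dw (Suc n) \<omega> *\<^sub>R L U n \<omega>)"
proof -
  have V: "L U n \<omega> \<in> V" "U n \<omega> \<in> V" using assms by (auto intro: L_V)
  have "A (L U n \<omega>) = \<tau> *\<^sub>R (\<Sum>j<n. A (lterm j n (U j) \<omega>))"
    unfolding L_lterm using assms by (subst A_scale) (auto intro!: V_sum lterm_V A_sum)
  then have "(1 + dw (Suc n) \<omega>) *\<^sub>R A (L U n \<omega>) = \<tau> *\<^sub>R (\<Sum>j<n. lterm j (Suc n) (U j) \<omega>)"
    using assms by (simp add: lterm_Suc scaleR_sum_right[symmetric] scaleR_left_commute)
  moreover have "lterm n (Suc n) (U n) \<omega> = A (U n \<omega>)"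
    by (simp add: lterm_def)
  ultimately have "L U (Suc n) \<omega> = (1 + dw (Suc n) \<omega>) *\<^sub>R A (L U n \<omega>) + \<tau> *\<^sub>R A (U n \<omega>)"
    unfolding L_lterm[of U "Suc n"] by (simp add: scaleR_add_right)
  then show ?thesis
    using V by (simp add: A_add A_scale scaleR_add_left)
qed

lemma ritz_\<sigma>_V: "n < N \<Longrightarrow> ritz V a (\<sigma> (real n * \<tau>)) \<in> V"
proof -
  assume "n < N"
  then have "real n * \<tau> \<le> real N * \<tau>" using \<tau> by (intro mult_right_mono) auto
  also have "\<dots> = T" using N by simp
  finally have "real n * \<tau> \<in> {0..T}" using grid(1)[of n] by simp
  then have "\<sigma> (real n * \<tau>) \<in> H" using \<sigma> by blast
  then show ?thesis by (rule ritz_V)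
qed

lemma St_sqint: "U \<in> \<U> \<Longrightarrow> n \<le> N \<Longrightarrow> sqint (F n) (St U n)"
proof (induction n)
  case 0
  then show ?case using X0 by (simp add: sqint_const)
next
  case (Suc n)
  then have S: "sqint (F n) (St U n)" and U: "sqint (F n) (U n)" by (auto simp: Uspace_iff)
  have R: "sqint (F n) (\<lambda>\<omega>. St U n \<omega> + ritz V a (\<sigma> (real n * \<tau>)))"
    using Suc.prems by (intro sqint_add F_subalgebra S sqint_const ritz_\<sigma>_V) auto
  have "sqint (F (Suc n)) (\<lambda>\<omega>. A ((St U n \<omega> + \<tau> *\<^sub>R U n \<omega>) + dw (Suc n) \<omega> *\<^sub>R (St U n \<omega> + ritz V a (\<sigma> (real n * \<tau>)))))"
    by (intro sqint_A F_subalgebra sqint_add sqint_dw R sqint_Suc sqint_lincomb S U)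
  then show ?case by simp
qed

lemma L_sqint: "U \<in> \<U> \<Longrightarrow> n \<le> N \<Longrightarrow> sqint (F n) (L U n)"
proof (induction n)
  case 0
  then show ?case by (simp add: sqint_const L_0)
next
  case (Suc n)
  then have S: "sqint (F n) (L U n)" and U: "sqint (F n) (U n)" by (auto simp: Uspace_iff)
  have "sqint (F (Suc n)) (\<lambda>\<omega>. A ((L U n \<omega> + \<tau> *\<^sub>R U n \<omega>) + dw (Suc n) \<omega> *\<^sub>R L U n \<omega>))"
    by (intro sqint_A F_subalgebra sqint_add sqint_dw sqint_Suc sqint_lincomb S U)
  moreover have "L U (Suc n) \<omega> = A ((L U n \<omega> + \<tau> *\<^sub>R U n \<omega>) + dw (Suc n) \<omega> *\<^sub>R L U n \<omega>)" if "\<omega> \<in> space M" for \<omega>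
    using Suc.prems that by (intro L_Suc Uspace_V) auto
  ultimately show ?case by (subst sqint_cong) auto
qed

lemma St_lincomb:
  assumes "U \<in> \<U>" "Z \<in> \<U>" "\<omega> \<in> space M" "n \<le> N"
  shows "St (\<lambda>n \<omega>. U n \<omega> + c *\<^sub>R Z n \<omega>) n \<omega> = St U n \<omega> + c *\<^sub>R L Z n \<omega>"
  using assms(4)
proof (induction n)
  case 0
  then show ?case by (simp add: L_0)
next
  case (Suc n)
  define r where "r = ritz V a (\<sigma> (real n * \<tau>))"
  define x where "x = St U n \<omega>"
  define y where "y = L Z n \<omega>"
  have V: "x \<in> V" "y \<in> V" "r \<in> V" "U n \<omega> \<in> V" "Z n \<omega> \<in> V"
    using St_sqint[OF assms(1), of n] L_sqint[OF assms(2), of n] Suc.prems assms ritz_\<sigma>_V[of n]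
    by (auto simp: sqint_def x_def y_def r_def intro!: Uspace_V)
  have LS: "L Z (Suc n) \<omega> = A ((y + \<tau> *\<^sub>R Z n \<omega>) + dw (Suc n) \<omega> *\<^sub>R y)"
    unfolding y_def using Suc.prems assms by (intro L_Suc Uspace_V) auto
  have "St (\<lambda>n \<omega>. U n \<omega> + c *\<^sub>R Z n \<omega>) (Suc n) \<omega> =
      A (x + c *\<^sub>R y + \<tau> *\<^sub>R (U n \<omega> + c *\<^sub>R Z n \<omega>) + dw (Suc n) \<omega> *\<^sub>R (x + c *\<^sub>R y + r))"
    using Suc by (simp add: x_def y_def r_def)
  also have "\<dots> = A ((x + \<tau> *\<^sub>R U n \<omega> + dw (Suc n) \<omega> *\<^sub>R (x + r)) + c *\<^sub>R ((y + \<tau> *\<^sub>R Z n \<omega>) + dw (Suc n) \<omega> *\<^sub>R y))"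
    by (rule arg_cong[of _ _ A]) (simp add: algebra_simps)
  also have "\<dots> = A (x + \<tau> *\<^sub>R U n \<omega> + dw (Suc n) \<omega> *\<^sub>R (x + r)) + c *\<^sub>R L Z (Suc n) \<omega>"
    unfolding LS using V by (subst A_add) (simp_all add: A_scale)
  finally show ?case by (simp add: x_def r_def)
qed

text \<open>Linearity is read off the affine state map: L U is the difference of the states for U
  and for the zero control.\<close>

lemma L_lincomb:
  assumes "U \<in> \<U>" "Z \<in> \<U>" "\<omega> \<in> space M" "n \<le> N"
  shows "L (\<lambda>n \<omega>. U n \<omega> + c *\<^sub>R Z n \<omega>) n \<omega> = L U n \<omega> + c *\<^sub>R L Z n \<omega>"
proof -
  have "St (\<lambda>n \<omega>. U n \<omega> + c *\<^sub>R Z n \<omega>) n \<omega> = St (\<lambda>n \<omega>. 0) n \<omega> + L (\<lambda>n \<omega>. U n \<omega> + c *\<^sub>R Z n \<omega>) n \<omega>"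
    using St_lincomb[of "\<lambda>n \<omega>. 0" "\<lambda>n \<omega>. U n \<omega> + c *\<^sub>R Z n \<omega>" \<omega> n 1] assms
    by (simp add: Uspace_lincomb) (simp add: Uspace_iff sqint_const)
  moreover have "St U n \<omega> = St (\<lambda>n \<omega>. 0) n \<omega> + L U n \<omega>"
    using St_lincomb[of "\<lambda>n \<omega>. 0" U \<omega> n 1] assms by (simp add: Uspace_iff sqint_const)
  ultimately show ?thesis using St_lincomb[OF assms, of c] by simp
qed

lemma expectation_A_energy:
  assumes "sqint M v"
  shows "expectation (\<lambda>\<omega>. (norm (A (v \<omega>)))\<^sup>2) + 2 * \<tau> * expectation (\<lambda>\<omega>. a (A (v \<omega>)) (A (v \<omega>)))
    \<le> expectation (\<lambda>\<omega>. (norm (v \<omega>))\<^sup>2)"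
proof -
  have Av: "sqint M (\<lambda>\<omega>. A (v \<omega>))" using assms by (intro sqint_A) (simp add: subalgebra_def)
  \<comment> \<open>The form a carries no measurability or continuity assumption. Its integrability
    is obtained from the weak equation, which writes it through inner products.\<close>
  have "integrable M (\<lambda>\<omega>. (inner (v \<omega>) (A (v \<omega>)) - (norm (A (v \<omega>)))\<^sup>2) / \<tau>)"
    using sqint_inner_integrable[OF assms Av] sqint_integrable[OF Av] by simp
  moreover have "(inner (v \<omega>) (A (v \<omega>)) - (norm (A (v \<omega>)))\<^sup>2) / \<tau> = a (A (v \<omega>)) (A (v \<omega>))" if "\<omega> \<in> space M" for \<omega>
  proof -
    have "inner (v \<omega>) (A (v \<omega>)) - (norm (A (v \<omega>)))\<^sup>2 = a (A (v \<omega>)) (A (v \<omega>)) * \<tau>"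
      using A0_weak[OF \<tau>, of "v \<omega>" "A (v \<omega>)"] sqint_V[OF assms that]
      by (simp add: power2_norm_eq_inner mult.commute)
    then show ?thesis using \<tau> by (simp only: nonzero_mult_div_cancel_right)
  qed
  ultimately have a_int: "integrable M (\<lambda>\<omega>. a (A (v \<omega>)) (A (v \<omega>)))"
    by (simp cong: Bochner_Integration.integrable_cong)
  have "expectation (\<lambda>\<omega>. (norm (A (v \<omega>)))\<^sup>2) + 2 * \<tau> * expectation (\<lambda>\<omega>. a (A (v \<omega>)) (A (v \<omega>)))
      = expectation (\<lambda>\<omega>. (norm (A (v \<omega>)))\<^sup>2 + 2 * \<tau> * a (A (v \<omega>)) (A (v \<omega>)))"
    using a_int sqint_integrable[OF Av] by simp
  also have "\<dots> \<le> expectation (\<lambda>\<omega>. (norm (v \<omega>))\<^sup>2)"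
    using a_int sqint_integrable[OF Av] sqint_integrable[OF assms] A0_energy[OF \<tau>] sqint_V[OF assms]
    by (intro integral_mono) auto
  finally show ?thesis .
qed

text \<open>The factor \<open>1 + 2 * \<tau>\<close> collects one \<tau> from the isometry for the
  noise and one from Young's inequality for the control term. The bound \<tau> \<le> 1 absorbs the
  square of \<tau> in front of the control.\<close>

lemma L_energy_step:
  assumes Z: "Z \<in> \<U>" and n: "n < N"
  shows "expectation (\<lambda>\<omega>. (norm (L Z (Suc n) \<omega>))\<^sup>2) + 2 * \<tau> * expectation (\<lambda>\<omega>. a (L Z (Suc n) \<omega>) (L Z (Suc n) \<omega>))
    \<le> (1 + 2 * \<tau>) * expectation (\<lambda>\<omega>. (norm (L Z n \<omega>))\<^sup>2) + 2 * \<tau> * expectation (\<lambda>\<omega>. (norm (Z n \<omega>))\<^sup>2)"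
proof -
  have l: "sqint (F n) (L Z n)" and z: "sqint (F n) (Z n)"
    using L_sqint[OF Z, of n] Z n by (auto simp: Uspace_iff)
  have lz: "sqint (F n) (\<lambda>\<omega>. L Z n \<omega> + \<tau> *\<^sub>R Z n \<omega>)"
    by (intro sqint_lincomb F_subalgebra l z)
  define v where "v \<omega> = (L Z n \<omega> + \<tau> *\<^sub>R Z n \<omega>) + dw (Suc n) \<omega> *\<^sub>R L Z n \<omega>" for \<omega>
  have v: "sqint M v"
    unfolding v_def by (rule sqint_F_M[of "Suc n"]) (intro sqint_add F_subalgebra sqint_dw sqint_Suc lz l)
  have eq: "L Z (Suc n) \<omega> = A (v \<omega>)" if "\<omega> \<in> space M" for \<omega>
    unfolding v_def using n that Z by (intro L_Suc Uspace_V) auto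
  have "expectation (\<lambda>\<omega>. (norm (L Z (Suc n) \<omega>))\<^sup>2) + 2 * \<tau> * expectation (\<lambda>\<omega>. a (L Z (Suc n) \<omega>) (L Z (Suc n) \<omega>))
      = expectation (\<lambda>\<omega>. (norm (A (v \<omega>)))\<^sup>2) + 2 * \<tau> * expectation (\<lambda>\<omega>. a (A (v \<omega>)) (A (v \<omega>)))"
    by (simp add: eq cong: Bochner_Integration.integral_cong)
  also have "\<dots> \<le> expectation (\<lambda>\<omega>. (norm (v \<omega>))\<^sup>2)"
    by (rule expectation_A_energy[OF v])
  also have "\<dots> = expectation (\<lambda>\<omega>. (norm (L Z n \<omega> + \<tau> *\<^sub>R Z n \<omega>))\<^sup>2) + \<tau> * expectation (\<lambda>\<omega>. (norm (L Z n \<omega>))\<^sup>2)"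
    unfolding v_def by (rule expectation_norm_dw_add[OF lz l])
  also have "expectation (\<lambda>\<omega>. (norm (L Z n \<omega> + \<tau> *\<^sub>R Z n \<omega>))\<^sup>2) \<le>
      expectation (\<lambda>\<omega>. (1 + \<tau>) * (norm (L Z n \<omega>))\<^sup>2 + 2 * \<tau> * (norm (Z n \<omega>))\<^sup>2)"
  proof (rule integral_mono)
    fix \<omega>
    define p q where "p = norm (L Z n \<omega>)" and "q = norm (Z n \<omega>)"
    have "(norm (L Z n \<omega> + \<tau> *\<^sub>R Z n \<omega>))\<^sup>2 \<le> (p + \<tau> * q)\<^sup>2"
      using norm_triangle_ineq[of "L Z n \<omega>" "\<tau> *\<^sub>R Z n \<omega>"] T by (intro power_mono) (auto simp: p_def q_def)
    also have "\<dots> = p\<^sup>2 + \<tau> * (2 * p * q) + \<tau> * (\<tau> * q\<^sup>2)"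
      by (simp add: power2_eq_square algebra_simps)
    also have "\<dots> \<le> p\<^sup>2 + \<tau> * (p\<^sup>2 + q\<^sup>2) + \<tau> * (1 * q\<^sup>2)"
      using \<tau> step_le sum_squares_bound[of p q] by (intro add_mono mult_left_mono mult_right_mono) auto
    also have "\<dots> = (1 + \<tau>) * p\<^sup>2 + 2 * \<tau> * q\<^sup>2" by (simp add: algebra_simps)
    finally show "(norm (L Z n \<omega> + \<tau> *\<^sub>R Z n \<omega>))\<^sup>2 \<le> (1 + \<tau>) * (norm (L Z n \<omega>))\<^sup>2 + 2 * \<tau> * (norm (Z n \<omega>))\<^sup>2"
      by (simp only: p_def q_def)
  qed (use sqint_integrable[OF lz] sqint_integrable[OF l] sqint_integrable[OF z] in auto)
  also have "\<dots> = (1 + \<tau>) * expectation (\<lambda>\<omega>. (norm (L Z n \<omega>))\<^sup>2) + 2 * \<tau> * expectation (\<lambda>\<omega>. (norm (Z n \<omega>))\<^sup>2)"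
    using sqint_integrable[OF l] sqint_integrable[OF z] by simp
  finally show ?thesis by (simp add: algebra_simps)
qed

text \<open>Discrete Gronwall inequality. The gradient sum is carried through the induction, where
  the growth factor, being at least 1, may multiply it too. The exponential arises from
  \<open>1 + 2 * \<tau> \<le> exp (2 * \<tau>)\<close> over N steps of total length T.\<close>

lemma L_energy:
  assumes Z: "Z \<in> \<U>" and "n \<le> N"
  shows "expectation (\<lambda>\<omega>. (norm (L Z n \<omega>))\<^sup>2) + 2 * \<tau> * (\<Sum>i\<in>{1..n}. expectation (\<lambda>\<omega>. a (L Z i \<omega>) (L Z i \<omega>)))
    \<le> 2 * exp (2 * T) * normU2 M T N Z"
proof -
  define x where "x n = expectation (\<lambda>\<omega>. (norm (L Z n \<omega>))\<^sup>2)" for n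
  define e where "e n = expectation (\<lambda>\<omega>. a (L Z n \<omega>) (L Z n \<omega>))" for n
  define u where "u n = expectation (\<lambda>\<omega>. (norm (Z n \<omega>))\<^sup>2)" for n
  have u: "u i \<ge> 0" for i by (simp add: u_def)
  have e: "e i \<ge> 0" if "i \<le> N" for i
    unfolding e_def using L_sqint[OF Z that] by (intro Bochner_Integration.integral_nonneg form_nonneg V_H) (rule sqint_V)
  have step: "x (Suc i) + 2 * \<tau> * e (Suc i) \<le> (1 + 2 * \<tau>) * x i + 2 * \<tau> * u i" if "i < N" for i
    unfolding x_def e_def u_def by (rule L_energy_step[OF Z that])
  have gronwall: "x m + 2 * \<tau> * (\<Sum>i\<in>{1..m}. e i) \<le> (1 + 2 * \<tau>) ^ m * (2 * \<tau> * (\<Sum>i<m. u i))" if "m \<le> N" for m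
    using that
  proof (induction m)
    case 0
    then show ?case by (simp add: x_def L_0)
  next
    case (Suc m)
    let ?E = "2 * \<tau> * (\<Sum>i\<in>{1..m}. e i)"
    have E: "?E \<ge> 0" using \<tau> Suc.prems by (intro mult_nonneg_nonneg sum_nonneg e) auto
    have "x (Suc m) + 2 * \<tau> * (\<Sum>i\<in>{1..Suc m}. e i) = x (Suc m) + 2 * \<tau> * e (Suc m) + ?E"
      by (simp add: algebra_simps)
    also have "\<dots> \<le> (1 + 2 * \<tau>) * x m + 2 * \<tau> * u m + ?E"
      using step[of m] Suc.prems by simp
    also have "\<dots> \<le> (1 + 2 * \<tau>) * (x m + ?E) + 2 * \<tau> * u m"
    proof -
      have "p + q + r \<le> p + (1 + s) * r + q" if "0 \<le> s * r" for p q r s :: real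
        using that by (simp add: distrib_right)
      from this[of "2 * \<tau>" ?E] show ?thesis
        using mult_nonneg_nonneg[of "2 * \<tau>" ?E] E \<tau> by (simp only: distrib_left)
    qed
    also have "\<dots> \<le> (1 + 2 * \<tau>) * ((1 + 2 * \<tau>) ^ m * (2 * \<tau> * (\<Sum>i<m. u i))) + (1 + 2 * \<tau>) ^ Suc m * (2 * \<tau> * u m)"
    proof (rule add_mono)
      show "(1 + 2 * \<tau>) * (x m + ?E) \<le> (1 + 2 * \<tau>) * ((1 + 2 * \<tau>) ^ m * (2 * \<tau> * (\<Sum>i<m. u i)))"
        using Suc \<tau> by (intro mult_left_mono) auto
      have "1 * (2 * \<tau> * u m) \<le> (1 + 2 * \<tau>) ^ Suc m * (2 * \<tau> * u m)"
        using T N u[of m] by (intro mult_right_mono one_le_power) auto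
      then show "2 * \<tau> * u m \<le> (1 + 2 * \<tau>) ^ Suc m * (2 * \<tau> * u m)" by simp
    qed
    also have "\<dots> = (1 + 2 * \<tau>) ^ Suc m * (2 * \<tau> * (\<Sum>i<Suc m. u i))"
      by (simp only: sum.lessThan_Suc power_Suc distrib_left mult.assoc)
    finally show ?case .
  qed
  have "(1 + 2 * \<tau>) ^ n \<le> (1 + 2 * \<tau>) ^ N"
    using \<tau> assms(2) by (intro power_increasing) auto
  also have "\<dots> \<le> exp (2 * \<tau>) ^ N"
    using \<tau> by (intro power_mono exp_ge_add_one_self) auto
  also have "\<dots> = exp (2 * T)"
    using N by (simp add: exp_of_nat_mult[symmetric])
  finally have c: "(1 + 2 * \<tau>) ^ n \<le> exp (2 * T)" .
  have "(\<Sum>i<n. u i) \<le> (\<Sum>i<N. u i)"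
    using assms(2) u by (intro sum_mono2) auto
  then have "2 * \<tau> * (\<Sum>i<n. u i) \<le> 2 * normU2 M T N Z"
    using \<tau> unfolding normU2_def u_def[symmetric] atLeast0LessThan mult.assoc by (intro mult_left_mono) auto
  moreover have "0 \<le> 2 * \<tau> * (\<Sum>i<n. u i)"
    using \<tau> u by (intro mult_nonneg_nonneg sum_nonneg) auto
  ultimately have "(1 + 2 * \<tau>) ^ n * (2 * \<tau> * (\<Sum>i<n. u i)) \<le> exp (2 * T) * (2 * normU2 M T N Z)"
    by (rule mult_mono[OF c _ exp_ge_zero])
  with gronwall[OF assms(2)] show ?thesis
    unfolding x_def e_def by (simp add: mult.commute mult.left_commute)
qed

section \<open>Adjoints as conditional expectations\<close>

lemma expectation_Cauchy_Schwarz: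
  assumes f: "sqint M f" and g: "sqint M g"
  shows "\<bar>expectation (\<lambda>\<omega>. inner (f \<omega>) (g \<omega>))\<bar> \<le>
    sqrt (expectation (\<lambda>\<omega>. (norm (f \<omega>))\<^sup>2)) * sqrt (expectation (\<lambda>\<omega>. (norm (g \<omega>))\<^sup>2))"
proof -
  have "(expectation (\<lambda>\<omega>. inner (f \<omega>) (g \<omega>)))\<^sup>2 \<le> expectation (\<lambda>\<omega>. (norm (f \<omega>))\<^sup>2) * expectation (\<lambda>\<omega>. (norm (g \<omega>))\<^sup>2)"
  proof (rule quadratic_nonneg_discriminant)
    fix t :: real
    have "0 \<le> expectation (\<lambda>\<omega>. (norm (f \<omega> + t *\<^sub>R g \<omega>))\<^sup>2)" by simp
    also have "\<dots> = expectation (\<lambda>\<omega>. (norm (f \<omega>))\<^sup>2 + 2 * t * inner (f \<omega>) (g \<omega>) + t\<^sup>2 * (norm (g \<omega>))\<^sup>2)"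
      unfolding power2_norm_eq_inner
      by (simp add: inner_add_left inner_add_right inner_commute power2_eq_square algebra_simps)
    also have "\<dots> = expectation (\<lambda>\<omega>. (norm (f \<omega>))\<^sup>2) + 2 * t * expectation (\<lambda>\<omega>. inner (f \<omega>) (g \<omega>)) + t\<^sup>2 * expectation (\<lambda>\<omega>. (norm (g \<omega>))\<^sup>2)"
      using sqint_integrable[OF f] sqint_integrable[OF g] sqint_inner_integrable[OF f g] by simp
    finally show "0 \<le> expectation (\<lambda>\<omega>. (norm (f \<omega>))\<^sup>2) + 2 * t * expectation (\<lambda>\<omega>. inner (f \<omega>) (g \<omega>)) + t\<^sup>2 * expectation (\<lambda>\<omega>. (norm (g \<omega>))\<^sup>2)" .
  qed simp
  then have "sqrt ((expectation (\<lambda>\<omega>. inner (f \<omega>) (g \<omega>)))\<^sup>2) \<le> sqrt (expectation (\<lambda>\<omega>. (norm (f \<omega>))\<^sup>2) * expectation (\<lambda>\<omega>. (norm (g \<omega>))\<^sup>2))"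
    by (rule real_sqrt_le_mono)
  then show ?thesis by (simp add: real_sqrt_mult)
qed

text \<open>Induction on the number of factors: each new increment is independent of f and of the
  factors already present, and the isometry multiplies the second moment by exactly
  \<open>1 + \<tau>\<close>. The case \<open>d = 0\<close> is the empty product.\<close>

lemma sqint_prod_dw:
  assumes f: "sqint (F n) f"
  shows "sqint (F (Suc n + d)) (\<lambda>\<omega>. (\<Prod>k\<in>{n+2..Suc n + d}. 1 + dw k \<omega>) *\<^sub>R f \<omega>) \<and>
    expectation (\<lambda>\<omega>. (norm ((\<Prod>k\<in>{n+2..Suc n + d}. 1 + dw k \<omega>) *\<^sub>R f \<omega>))\<^sup>2) = (1 + \<tau>) ^ d * expectation (\<lambda>\<omega>. (norm (f \<omega>))\<^sup>2)"
proof (induction d)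
  case 0
  then show ?case using f by (simp add: sqint_Suc)
next
  case (Suc d)
  define m where "m = Suc n + d"
  define g where "g = (\<lambda>\<omega>. (\<Prod>k\<in>{n+2..m}. 1 + dw k \<omega>) *\<^sub>R f \<omega>)"
  have g: "sqint (F m) g" and E: "expectation (\<lambda>\<omega>. (norm (g \<omega>))\<^sup>2) = (1 + \<tau>) ^ d * expectation (\<lambda>\<omega>. (norm (f \<omega>))\<^sup>2)"
    using Suc unfolding m_def g_def by blast+
  have "{n+2..Suc m} = insert (Suc m) {n+2..m}" by (auto simp: m_def)
  then have eq: "(\<Prod>k\<in>{n+2..Suc m}. 1 + dw k \<omega>) *\<^sub>R f \<omega> = g \<omega> + dw (Suc m) \<omega> *\<^sub>R g \<omega>" for \<omega>
    by (simp add: g_def algebra_simps)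
  have "sqint (F (Suc m)) (\<lambda>\<omega>. g \<omega> + dw (Suc m) \<omega> *\<^sub>R g \<omega>)"
    by (intro sqint_add F_subalgebra sqint_Suc g sqint_dw)
  moreover have "expectation (\<lambda>\<omega>. (norm (g \<omega> + dw (Suc m) \<omega> *\<^sub>R g \<omega>))\<^sup>2) = (1 + \<tau>) ^ Suc d * expectation (\<lambda>\<omega>. (norm (f \<omega>))\<^sup>2)"
    unfolding expectation_norm_dw_add[OF g g] E by (simp only: power_Suc distrib_right mult_1_left mult.assoc)
  ultimately show ?case
    unfolding eq[symmetric] by (simp add: m_def)
qed

text \<open>
  The integrands of \<open>Y\<close> are in general not square integrable: later controls need not be independent of the
  factors \<open>1 + \<Delta>_k W\<close>. They are, however, bounded functionals on the \<open>F n\<close>-measurable processes,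
  because these factors multiply an \<open>F n\<close>-measurable process isometrically up to \<open>1 + \<tau>\<close>.
\<close>
definition dual_bounded :: "nat \<Rightarrow> ('w \<Rightarrow> 'a) \<Rightarrow> bool" where
  "dual_bounded n G \<longleftrightarrow> G \<in> borel_measurable M \<and> (\<exists>c\<ge>0. \<forall>Z. sqint (F n) Z \<longrightarrow>
     integrable M (\<lambda>\<omega>. inner (Z \<omega>) (G \<omega>)) \<and>
     \<bar>expectation (\<lambda>\<omega>. inner (Z \<omega>) (G \<omega>))\<bar> \<le> c * sqrt (expectation (\<lambda>\<omega>. (norm (Z \<omega>))\<^sup>2)))"

lemma dual_boundedD:
  "dual_bounded n G \<Longrightarrow> sqint (F n) Z \<Longrightarrow> integrable M (\<lambda>\<omega>. inner (Z \<omega>) (G \<omega>))"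
  by (auto simp: dual_bounded_def)

lemma dual_bounded_add:
  assumes "dual_bounded n G" "dual_bounded n G'"
  shows "dual_bounded n (\<lambda>\<omega>. G \<omega> + G' \<omega>)"
proof -
  from assms(1) obtain c where c: "c \<ge> 0"
    and G: "\<And>Z. sqint (F n) Z \<Longrightarrow> integrable M (\<lambda>\<omega>. inner (Z \<omega>) (G \<omega>))"
      "\<And>Z. sqint (F n) Z \<Longrightarrow> \<bar>expectation (\<lambda>\<omega>. inner (Z \<omega>) (G \<omega>))\<bar> \<le> c * sqrt (expectation (\<lambda>\<omega>. (norm (Z \<omega>))\<^sup>2))"
    unfolding dual_bounded_def by blast
  from assms(2) obtain c' where c': "c' \<ge> 0"
    and G': "\<And>Z. sqint (F n) Z \<Longrightarrow> integrable M (\<lambda>\<omega>. inner (Z \<omega>) (G' \<omega>))"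
      "\<And>Z. sqint (F n) Z \<Longrightarrow> \<bar>expectation (\<lambda>\<omega>. inner (Z \<omega>) (G' \<omega>))\<bar> \<le> c' * sqrt (expectation (\<lambda>\<omega>. (norm (Z \<omega>))\<^sup>2))"
    unfolding dual_bounded_def by blast
  show ?thesis
    unfolding dual_bounded_def
  proof (intro conjI exI[of _ "c + c'"] allI impI)
    show "(\<lambda>\<omega>. G \<omega> + G' \<omega>) \<in> borel_measurable M"
      using assms unfolding dual_bounded_def by (intro borel_measurable_add) auto
    fix Z assume Z: "sqint (F n) Z"
    show "integrable M (\<lambda>\<omega>. inner (Z \<omega>) (G \<omega> + G' \<omega>))"
      using G(1)[OF Z] G'(1)[OF Z] by (simp add: inner_add_right)
    have "expectation (\<lambda>\<omega>. inner (Z \<omega>) (G \<omega> + G' \<omega>)) = expectation (\<lambda>\<omega>. inner (Z \<omega>) (G \<omega>)) + expectation (\<lambda>\<omega>. inner (Z \<omega>) (G' \<omega>))"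
      using G(1)[OF Z] G'(1)[OF Z] by (simp add: inner_add_right)
    then show "\<bar>expectation (\<lambda>\<omega>. inner (Z \<omega>) (G \<omega> + G' \<omega>))\<bar> \<le> (c + c') * sqrt (expectation (\<lambda>\<omega>. (norm (Z \<omega>))\<^sup>2))"
      using G(2)[OF Z] G'(2)[OF Z] by (simp add: distrib_right)
  qed (use c c' in simp)
qed

lemma dual_bounded_sum:
  assumes "finite I" "\<And>i. i \<in> I \<Longrightarrow> dual_bounded n (f i)"
  shows "dual_bounded n (\<lambda>\<omega>. \<Sum>i\<in>I. f i \<omega>)"
  using assms
proof (induction I rule: finite_induct)
  case empty
  show ?case by (auto simp: dual_bounded_def intro!: exI[of _ 0])
qed (simp add: dual_bounded_add)

lemma lterm_adjoint:
  assumes f: "f \<omega> \<in> V" and g: "g \<omega> \<in> V"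
  shows "inner (lterm n m f \<omega>) (g \<omega>) = inner (f \<omega>) (lterm n m g \<omega>)"
  using A_pow_sym[OF f g] by (simp add: lterm_def)

lemma inner_lterm:
  assumes f: "f \<omega> \<in> V" and g: "g \<omega> \<in> V"
  shows "inner (f \<omega>) (lterm n m g \<omega>) = inner ((\<Prod>k\<in>{n+2..m}. 1 + dw k \<omega>) *\<^sub>R f \<omega>) ((A ^^ (m - n)) (g \<omega>))"
  by (simp add: lterm_def)

text \<open>The random factors are moved from g, where they could destroy square integrability, to
  the adapted test function, where \<open>sqint_prod_dw\<close> controls them. The contractive
  resolvent powers stay with g, and Cauchy-Schwarz concludes.\<close>

lemma lterm_dual_bounded:
  assumes g: "sqint M g" and "n < m"
  shows "dual_bounded n (lterm n m g)"
proof -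
  obtain d where d: "m = Suc n + d" using assms(2) less_imp_Suc_add by auto
  have M: "subalgebra M M" by (simp add: subalgebra_def)
  have Ag: "sqint M (\<lambda>\<omega>. (A ^^ (m - n)) (g \<omega>))" by (rule sqint_A_pow[OF M g])
  define c where "c = sqrt ((1 + \<tau>) ^ d) * sqrt (expectation (\<lambda>\<omega>. (norm ((A ^^ (m - n)) (g \<omega>)))\<^sup>2))"
  show ?thesis
    unfolding dual_bounded_def
  proof (intro conjI exI[of _ c] allI impI)
    have [measurable]: "(\<lambda>\<omega>. (A ^^ (m - n)) (g \<omega>)) \<in> borel_measurable M"
      using Ag by (rule sqint_measurable)
    show "lterm n m g \<in> borel_measurable M"
      unfolding lterm_def[abs_def] by measurable
    fix Z assume Z: "sqint (F n) Z"
    let ?PZ = "\<lambda>\<omega>. (\<Prod>k\<in>{n+2..m}. 1 + dw k \<omega>) *\<^sub>R Z \<omega>"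
    have PZ: "sqint M ?PZ" and E: "expectation (\<lambda>\<omega>. (norm (?PZ \<omega>))\<^sup>2) = (1 + \<tau>) ^ d * expectation (\<lambda>\<omega>. (norm (Z \<omega>))\<^sup>2)"
      using sqint_F_M[OF conjunct1[OF sqint_prod_dw[OF Z, of d]]] conjunct2[OF sqint_prod_dw[OF Z, of d]]
      unfolding d .
    have eq: "inner (Z \<omega>) (lterm n m g \<omega>) = inner (?PZ \<omega>) ((A ^^ (m - n)) (g \<omega>))" if "\<omega> \<in> space M" for \<omega>
      using inner_lterm sqint_V[OF Z that] sqint_V[OF g that] .
    show "integrable M (\<lambda>\<omega>. inner (Z \<omega>) (lterm n m g \<omega>))"
      using sqint_inner_integrable[OF PZ Ag]
      by (rule Bochner_Integration.integrable_cong[OF refl, THEN iffD2, rotated]) (rule eq)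
    have "\<bar>expectation (\<lambda>\<omega>. inner (Z \<omega>) (lterm n m g \<omega>))\<bar> = \<bar>expectation (\<lambda>\<omega>. inner (?PZ \<omega>) ((A ^^ (m - n)) (g \<omega>)))\<bar>"
      by (intro arg_cong[of _ _ abs] Bochner_Integration.integral_cong refl eq)
    also have "\<dots> \<le> c * sqrt (expectation (\<lambda>\<omega>. (norm (Z \<omega>))\<^sup>2))"
      using expectation_Cauchy_Schwarz[OF PZ Ag] unfolding E real_sqrt_mult c_def by (simp only: mult.assoc mult.commute mult.left_commute)
    finally show "\<bar>expectation (\<lambda>\<omega>. inner (Z \<omega>) (lterm n m g \<omega>))\<bar> \<le> c * sqrt (expectation (\<lambda>\<omega>. (norm (Z \<omega>))\<^sup>2))" .
  qed (use \<tau> in \<open>simp add: c_def\<close>)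
qed

lemma sqint_inner_onb:
  assumes "sqint (F n) Z" "b \<in> onb V"
  shows "sqint (F n) (\<lambda>\<omega>. inner (Z \<omega>) b *\<^sub>R b)"
proof (rule sqint_dominated[OF _ F_subalgebra _ sqint_integrable[OF assms(1)]])
  show "(\<lambda>\<omega>. inner (Z \<omega>) b *\<^sub>R b) \<in> borel_measurable (F n)"
    using sqint_measurable[OF assms(1)] by simp
  show "(norm (inner (Z \<omega>) b *\<^sub>R b))\<^sup>2 \<le> (norm (Z \<omega>))\<^sup>2" for \<omega>
    using Cauchy_Schwarz_ineq2[of "Z \<omega>" b] onb(4)[OF assms(2)] by (intro power_mono) auto
qed (use assms in simp)

text \<open>Both parts work coordinatewise. Test functions of the form
  \<open>Z \<omega> *\<^sub>R b\<close> turn the vector bound into the scalar bound that makes each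
  coordinate square integrable. The pairing identity needs only Z to be V-valued, since then only
  the coordinates of G in V are seen.\<close>

lemma cond_expV_dual:
  assumes G: "dual_bounded n G"
  shows "sqint (F n) (cond_expV M (F n) V G)"
    and "sqint (F n) Z \<Longrightarrow> expectation (\<lambda>\<omega>. inner (Z \<omega>) (cond_expV M (F n) V G \<omega>)) = expectation (\<lambda>\<omega>. inner (Z \<omega>) (G \<omega>))"
proof -
  interpret S: finite_measure_subalgebra M "F n"
    by unfold_locales (rule F_subalgebra)
  have [measurable]: "G \<in> borel_measurable M" using G by (simp add: dual_bounded_def)
  obtain c where c: "c \<ge> 0" "\<And>Z. sqint (F n) Z \<Longrightarrow> integrable M (\<lambda>\<omega>. inner (Z \<omega>) (G \<omega>)) \<and>
     \<bar>expectation (\<lambda>\<omega>. inner (Z \<omega>) (G \<omega>))\<bar> \<le> c * sqrt (expectation (\<lambda>\<omega>. (norm (Z \<omega>))\<^sup>2))"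
    using G unfolding dual_bounded_def by blast
  define g where "g b = real_cond_exp M (F n) (\<lambda>\<omega>. inner (G \<omega>) b)" for b
  have gm: "g b \<in> borel_measurable (F n)" for b by (simp add: g_def)
  have g2: "integrable M (\<lambda>\<omega>. (g b \<omega>)\<^sup>2)" if b: "b \<in> onb V" for b
    unfolding g_def
  proof (rule S.real_cond_exp_square_integrable[OF _ c(1)])
    show "integrable M (\<lambda>\<omega>. inner (G \<omega>) b)"
      using dual_boundedD[OF G sqint_const[of b]] b by (simp add: inner_commute)
    fix Z :: "'w \<Rightarrow> real" assume Z: "Z \<in> borel_measurable (F n)" "integrable M (\<lambda>\<omega>. (Z \<omega>)\<^sup>2)"
    have "sqint (F n) (\<lambda>\<omega>. Z \<omega> *\<^sub>R b)"
      using Z b onb(4)[OF b] by (simp add: sqint_def)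
    from conjunct2[OF c(2)[OF this]]
    show "\<bar>expectation (\<lambda>\<omega>. Z \<omega> * inner (G \<omega>) b)\<bar> \<le> c * sqrt (expectation (\<lambda>\<omega>. (Z \<omega>)\<^sup>2))"
      using onb(4)[OF b] by (simp add: inner_commute)
  qed
  have ce: "cond_expV M (F n) V G = (\<lambda>\<omega>. \<Sum>b\<in>onb V. g b \<omega> *\<^sub>R b)"
    by (rule ext) (simp add: cond_expV_def g_def)
  show "sqint (F n) (cond_expV M (F n) V G)"
    unfolding ce
  proof (rule sqint_sum[OF F_subalgebra onb(1)])
    fix b assume b: "b \<in> onb V"
    show "sqint (F n) (\<lambda>\<omega>. g b \<omega> *\<^sub>R b)"
      using gm g2[OF b] b onb(4)[OF b] by (simp add: sqint_def)
  qed
  assume Z: "sqint (F n) Z"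
  have int: "integrable M (\<lambda>\<omega>. inner (Z \<omega>) b * inner (G \<omega>) b)" if b: "b \<in> onb V" for b
    using dual_boundedD[OF G sqint_inner_onb[OF Z b]] by (simp add: inner_commute)
  have Zb: "(\<lambda>\<omega>. inner (Z \<omega>) b) \<in> borel_measurable (F n)" for b
    using sqint_measurable[OF Z] by simp
  note ci = S.real_cond_exp_intg[OF int Zb, folded g_def]
  have "expectation (\<lambda>\<omega>. inner (Z \<omega>) (cond_expV M (F n) V G \<omega>)) = expectation (\<lambda>\<omega>. \<Sum>b\<in>onb V. inner (Z \<omega>) b * g b \<omega>)"
    unfolding ce by (simp add: inner_sum_right mult.commute)
  also have "\<dots> = (\<Sum>b\<in>onb V. expectation (\<lambda>\<omega>. inner (Z \<omega>) b * g b \<omega>))"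
    using ci(1) by (intro Bochner_Integration.integral_sum) auto
  also have "\<dots> = (\<Sum>b\<in>onb V. expectation (\<lambda>\<omega>. inner (Z \<omega>) b * inner (G \<omega>) b))"
    using ci(2) by (intro sum.cong refl) simp
  also have "\<dots> = expectation (\<lambda>\<omega>. \<Sum>b\<in>onb V. inner (Z \<omega>) b * inner (G \<omega>) b)"
    using int by (intro Bochner_Integration.integral_sum[symmetric]) auto
  also have "\<dots> = expectation (\<lambda>\<omega>. inner (Z \<omega>) (G \<omega>))"
  proof (intro Bochner_Integration.integral_cong refl)
    fix \<omega> assume "\<omega> \<in> space M"
    then show "(\<Sum>b\<in>onb V. inner (Z \<omega>) b * inner (G \<omega>) b) = inner (Z \<omega>) (G \<omega>)"
      using inner_expand[OF sqint_V[OF Z], of \<omega> "G \<omega>"] by (simp add: inner_commute mult.commute)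
  qed
  finally show "expectation (\<lambda>\<omega>. inner (Z \<omega>) (cond_expV M (F n) V G \<omega>)) = expectation (\<lambda>\<omega>. inner (Z \<omega>) (G \<omega>))" .
qed

text \<open>Of the two step sizes in the pairing of L U with X, one from L and one from the time
  sum, \<open>innerU\<close> consumes one and the other remains here. The terminal pairing has no
  time sum, so \<open>adjT\<close> has no such factor.\<close>

definition adjX :: "(nat \<Rightarrow> 'w \<Rightarrow> 'a) \<Rightarrow> nat \<Rightarrow> 'w \<Rightarrow> 'a" where
  "adjX X n \<omega> = \<tau> *\<^sub>R cond_expV M (F n) V (\<lambda>\<omega>'. \<Sum>j\<in>{n+1..N}. lterm n j (X j) \<omega>') \<omega>"

definition adjT :: "('w \<Rightarrow> 'a) \<Rightarrow> nat \<Rightarrow> 'w \<Rightarrow> 'a" where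
  "adjT \<xi> n \<omega> = cond_expV M (F n) V (lterm n N \<xi>) \<omega>"

lemma Yadj_eq: "Yadj M W V a T N \<alpha> X n \<omega> = - adjX X n \<omega> - \<alpha> *\<^sub>R adjT (X N) n \<omega>"
  unfolding Yadj_def adjX_def adjT_def lterm_def[abs_def] ..

lemma expectation_L_inner:
  assumes U: "U \<in> \<U>" and \<xi>: "sqint M \<xi>" and m: "m \<le> N"
  shows "expectation (\<lambda>\<omega>. inner (L U m \<omega>) (\<xi> \<omega>)) = \<tau> * (\<Sum>j<m. expectation (\<lambda>\<omega>. inner (U j \<omega>) (lterm j m \<xi> \<omega>)))"
proof -
  have "expectation (\<lambda>\<omega>. inner (L U m \<omega>) (\<xi> \<omega>)) = expectation (\<lambda>\<omega>. \<tau> * (\<Sum>j<m. inner (U j \<omega>) (lterm j m \<xi> \<omega>)))"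
  proof (intro Bochner_Integration.integral_cong refl)
    fix \<omega> assume w: "\<omega> \<in> space M"
    have "inner (L U m \<omega>) (\<xi> \<omega>) = \<tau> * (\<Sum>j<m. inner (lterm j m (U j) \<omega>) (\<xi> \<omega>))"
      by (simp add: L_lterm inner_sum_left)
    also have "(\<Sum>j<m. inner (lterm j m (U j) \<omega>) (\<xi> \<omega>)) = (\<Sum>j<m. inner (U j \<omega>) (lterm j m \<xi> \<omega>))"
      using m w U \<xi> by (intro sum.cong refl lterm_adjoint) (auto intro: Uspace_V sqint_V)
    finally show "inner (L U m \<omega>) (\<xi> \<omega>) = \<tau> * (\<Sum>j<m. inner (U j \<omega>) (lterm j m \<xi> \<omega>))" .
  qed
  also have "\<dots> = \<tau> * (\<Sum>j<m. expectation (\<lambda>\<omega>. inner (U j \<omega>) (lterm j m \<xi> \<omega>)))"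
  proof -
    have "integrable M (\<lambda>\<omega>. inner (U j \<omega>) (lterm j m \<xi> \<omega>))" if "j < m" for j
      using dual_boundedD[OF lterm_dual_bounded[OF \<xi> that]] U m that by (simp add: Uspace_iff)
    then show ?thesis by simp
  qed
  finally show ?thesis .
qed

lemma adjT_Uspace: "sqint M \<xi> \<Longrightarrow> adjT \<xi> \<in> \<U>"
  unfolding Uspace_iff adjT_def by (intro allI impI cond_expV_dual lterm_dual_bounded)

lemma adjT:
  assumes U: "U \<in> \<U>" and \<xi>: "sqint M \<xi>"
  shows "expectation (\<lambda>\<omega>. inner (L U N \<omega>) (\<xi> \<omega>)) = innerU M T N U (adjT \<xi>)"
proof -
  have "expectation (\<lambda>\<omega>. inner (U j \<omega>) (adjT \<xi> j \<omega>)) = expectation (\<lambda>\<omega>. inner (U j \<omega>) (lterm j N \<xi> \<omega>))" if "j < N" for j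
    unfolding adjT_def using U that by (intro cond_expV_dual(2) lterm_dual_bounded \<xi>) (auto simp: Uspace_iff)
  then show ?thesis
    unfolding expectation_L_inner[OF U \<xi> order_refl] innerU_def atLeast0LessThan by simp
qed

lemma sum_lterm_dual_bounded:
  assumes "\<And>j. j \<in> {1..N} \<Longrightarrow> sqint M (X j)"
  shows "dual_bounded n (\<lambda>\<omega>'. \<Sum>j\<in>{n+1..N}. lterm n j (X j) \<omega>')"
  by (rule dual_bounded_sum) (use assms in \<open>auto intro!: lterm_dual_bounded\<close>)

lemma adjX_Uspace:
  assumes "\<And>j. j \<in> {1..N} \<Longrightarrow> sqint M (X j)"
  shows "adjX X \<in> \<U>"
  unfolding Uspace_iff adjX_def
  by (intro allI impI sqint_scale F_subalgebra cond_expV_dual sum_lterm_dual_bounded assms)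

lemma adjX:
  assumes U: "U \<in> \<U>" and X: "\<And>j. j \<in> {1..N} \<Longrightarrow> sqint M (X j)"
  shows "innerX M T N (L U) X = innerU M T N U (adjX X)"
proof -
  define e where "e j m = expectation (\<lambda>\<omega>. inner (U j \<omega>) (lterm j m (X m) \<omega>))" for j m
  have *: "expectation (\<lambda>\<omega>. inner (U j \<omega>) (adjX X j \<omega>)) = \<tau> * (\<Sum>m\<in>{j+1..N}. e j m)" if j: "j < N" for j
  proof -
    have Uj: "sqint (F j) (U j)" using U j by (simp add: Uspace_iff)
    have "expectation (\<lambda>\<omega>. inner (U j \<omega>) (adjX X j \<omega>)) =
        \<tau> * expectation (\<lambda>\<omega>. inner (U j \<omega>) (cond_expV M (F j) V (\<lambda>\<omega>'. \<Sum>m\<in>{j+1..N}. lterm j m (X m) \<omega>') \<omega>))"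
      by (simp add: adjX_def)
    also have "\<dots> = \<tau> * expectation (\<lambda>\<omega>. inner (U j \<omega>) (\<Sum>m\<in>{j+1..N}. lterm j m (X m) \<omega>))"
      using cond_expV_dual(2)[OF sum_lterm_dual_bounded[of X j, OF X] Uj] by simp
    also have "\<dots> = \<tau> * (\<Sum>m\<in>{j+1..N}. e j m)"
    proof -
      have "integrable M (\<lambda>\<omega>. inner (U j \<omega>) (lterm j m (X m) \<omega>))" if "m \<in> {j+1..N}" for m
        using that by (intro dual_boundedD[OF lterm_dual_bounded Uj] X) auto
      then show ?thesis unfolding e_def by (simp add: inner_sum_right)
    qed
    finally show ?thesis .
  qed
  have "innerX M T N (L U) X = \<tau> * (\<Sum>m\<in>{1..N}. \<tau> * (\<Sum>j<m. e j m))"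
    unfolding innerX_def e_def using expectation_L_inner[OF U X] by simp
  also have "(\<Sum>m\<in>{1..N}. \<tau> * (\<Sum>j<m. e j m)) = \<tau> * (\<Sum>m\<in>{1..N}. \<Sum>j\<in>{j\<in>{..<N}. j < m}. e j m)"
    unfolding sum_distrib_left[symmetric] by (intro arg_cong[of _ _ "(*) \<tau>"] sum.cong refl) auto
  also have "(\<Sum>m\<in>{1..N}. \<Sum>j\<in>{j\<in>{..<N}. j < m}. e j m) = (\<Sum>j<N. \<Sum>m\<in>{m\<in>{1..N}. j < m}. e j m)"
    by (rule sum.swap_restrict) auto
  also have "\<dots> = (\<Sum>j<N. \<Sum>m\<in>{j+1..N}. e j m)"
    by (intro sum.cong refl) auto
  also have "\<tau> * (\<tau> * (\<Sum>j<N. \<Sum>m\<in>{j+1..N}. e j m)) = \<tau> * (\<Sum>j<N. expectation (\<lambda>\<omega>. inner (U j \<omega>) (adjX X j \<omega>)))"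
    using * by (simp add: sum_distrib_left)
  finally show ?thesis unfolding innerU_def atLeast0LessThan .
qed

section \<open>The reduced cost and gradient descent\<close>

abbreviation lc :: "(nat \<Rightarrow> 'w \<Rightarrow> 'a) \<Rightarrow> real \<Rightarrow> (nat \<Rightarrow> 'w \<Rightarrow> 'a) \<Rightarrow> nat \<Rightarrow> 'w \<Rightarrow> 'a" where
  "lc U c Z \<equiv> \<lambda>n \<omega>. U n \<omega> + c *\<^sub>R Z n \<omega>"

abbreviation "iU \<equiv> innerU M T N"
abbreviation "iX \<equiv> innerX M T N"
abbreviation "nU \<equiv> normU2 M T N"

lemma expectation_inner_lincomb:
  assumes "sqint M f" "sqint M g" "sqint M h"
  shows "expectation (\<lambda>\<omega>. inner (f \<omega> + c *\<^sub>R g \<omega>) (h \<omega>)) =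
    expectation (\<lambda>\<omega>. inner (f \<omega>) (h \<omega>)) + c * expectation (\<lambda>\<omega>. inner (g \<omega>) (h \<omega>))"
  using sqint_inner_integrable[OF assms(1,3)] sqint_inner_integrable[OF assms(2,3)]
  by (simp add: inner_add_left)

lemma Uspace_sqint: "U \<in> \<U> \<Longrightarrow> n < N \<Longrightarrow> sqint M (U n)"
  by (auto simp: Uspace_iff intro: sqint_F_M)

lemma L_sqint_M: "U \<in> \<U> \<Longrightarrow> n \<le> N \<Longrightarrow> sqint M (L U n)"
  by (rule sqint_F_M) (rule L_sqint)

lemma St_sqint_M: "U \<in> \<U> \<Longrightarrow> n \<le> N \<Longrightarrow> sqint M (St U n)"
  by (rule sqint_F_M) (rule St_sqint)

lemma innerU_lincomb:
  assumes "U \<in> \<U>" "Z \<in> \<U>" "Y \<in> \<U>"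
  shows "iU (lc U c Z) Y = iU U Y + c * iU Z Y"
proof -
  have "(\<Sum>n\<in>{0..<N}. expectation (\<lambda>\<omega>. inner (lc U c Z n \<omega>) (Y n \<omega>))) =
      (\<Sum>n\<in>{0..<N}. expectation (\<lambda>\<omega>. inner (U n \<omega>) (Y n \<omega>)) + c * expectation (\<lambda>\<omega>. inner (Z n \<omega>) (Y n \<omega>)))"
    using assms by (intro sum.cong refl expectation_inner_lincomb Uspace_sqint) auto
  then show ?thesis
    unfolding innerU_def by (simp add: sum.distrib sum_distrib_left[symmetric] distrib_left)
qed

lemma innerU_sym: "iU U Z = iU Z U"
  unfolding innerU_def by (simp add: inner_commute)

lemma innerU_self: "iU U U = nU U"
  by (simp add: innerU_def normU2_def power2_norm_eq_inner)

lemma normU2_nonneg: "0 \<le> nU U"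
  unfolding normU2_def using \<tau> by (intro mult_nonneg_nonneg sum_nonneg) auto

text \<open>The state part of the cost, doubled and polarised.\<close>

definition obs :: "(nat \<Rightarrow> 'w \<Rightarrow> 'a) \<Rightarrow> (nat \<Rightarrow> 'w \<Rightarrow> 'a) \<Rightarrow> real" where
  "obs X Y = iX X Y + \<alpha> * expectation (\<lambda>\<omega>. inner (X N \<omega>) (Y N \<omega>))"

lemma obs_sym: "obs X Y = obs Y X"
  by (simp add: obs_def innerX_def inner_commute)

lemma obs_nonneg: "0 \<le> obs X X"
  unfolding obs_def innerX_def using \<tau> \<alpha>
  by (intro add_nonneg_nonneg mult_nonneg_nonneg sum_nonneg Bochner_Integration.integral_nonneg) auto

lemma obs_lincomb:
  assumes "\<And>n. n \<le> N \<Longrightarrow> sqint M (X n)" "\<And>n. n \<le> N \<Longrightarrow> sqint M (Y n)" "\<And>n. n \<le> N \<Longrightarrow> sqint M (Z n)"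
    and "\<And>n \<omega>. n \<le> N \<Longrightarrow> \<omega> \<in> space M \<Longrightarrow> X' n \<omega> = X n \<omega> + c *\<^sub>R Y n \<omega>"
  shows "obs X' Z = obs X Z + c * obs Y Z"
proof -
  have "expectation (\<lambda>\<omega>. inner (X' n \<omega>) (Z n \<omega>)) =
      expectation (\<lambda>\<omega>. inner (X n \<omega>) (Z n \<omega>)) + c * expectation (\<lambda>\<omega>. inner (Y n \<omega>) (Z n \<omega>))" if "n \<le> N" for n
    using that assms by (simp add: expectation_inner_lincomb[symmetric] cong: Bochner_Integration.integral_cong)
  then show ?thesis
    unfolding obs_def innerX_def by (simp add: sum.distrib sum_distrib_left algebra_simps)
qed

text \<open>The form B of the overview.\<close>

definition hform :: "(nat \<Rightarrow> 'w \<Rightarrow> 'a) \<Rightarrow> (nat \<Rightarrow> 'w \<Rightarrow> 'a) \<Rightarrow> real" where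
  "hform U Z = iU U Z + obs (L U) (L Z)"

text \<open>The derivative of the reduced cost at U in direction Z: the full affine state of U is
  paired with the linear response to Z.\<close>

definition dJ :: "(nat \<Rightarrow> 'w \<Rightarrow> 'a) \<Rightarrow> (nat \<Rightarrow> 'w \<Rightarrow> 'a) \<Rightarrow> real" where
  "dJ U Z = iU U Z + obs (St U) (L Z)"

lemma hform_sym: "hform U Z = hform Z U"
  by (simp add: hform_def innerU_sym[of U] obs_sym[of "L U"])

lemma hform_ge: "nU U \<le> hform U U"
  by (simp add: hform_def innerU_self obs_nonneg)

lemma hform_lincomb:
  assumes "U \<in> \<U>" "Z \<in> \<U>" "Y \<in> \<U>"
  shows "hform (lc U c Z) Y = hform U Y + c * hform Z Y"
proof -
  have "obs (L (lc U c Z)) (L Y) = obs (L U) (L Y) + c * obs (L Z) (L Y)"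
    using assms by (intro obs_lincomb L_sqint_M L_lincomb)
  then show ?thesis using innerU_lincomb[OF assms] by (simp add: hform_def algebra_simps)
qed

lemma dJ_lincomb:
  assumes "U \<in> \<U>" "Z \<in> \<U>" "Y \<in> \<U>"
  shows "dJ (lc U c Z) Y = dJ U Y + c * hform Z Y"
proof -
  have "obs (St (lc U c Z)) (L Y) = obs (St U) (L Y) + c * obs (L Z) (L Y)"
    using assms by (intro obs_lincomb L_sqint_M St_sqint_M St_lincomb)
  then show ?thesis using innerU_lincomb[OF assms] by (simp add: dJ_def hform_def algebra_simps)
qed

lemma square_lincomb:
  assumes lin: "\<And>U Z Y c. U \<in> \<U> \<Longrightarrow> Z \<in> \<U> \<Longrightarrow> Y \<in> \<U> \<Longrightarrow> b (lc U c Z) Y = b U Y + c * b Z Y"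
    and sym: "\<And>U Z. b U Z = b Z U" and "U \<in> \<U>" "Z \<in> \<U>"
  shows "b (lc U c Z) (lc U c Z) = b U U + 2 * c * b U Z + c\<^sup>2 * b Z Z"
proof -
  have UZ: "lc U c Z \<in> \<U>" using assms(3,4) by (rule Uspace_lincomb)
  have "b (lc U c Z) (lc U c Z) = b U (lc U c Z) + c * b Z (lc U c Z)"
    by (rule lin[OF assms(3,4) UZ])
  also have "b U (lc U c Z) = b U U + c * b Z U"
    using lin[OF assms(3,4,3)] sym by metis
  also have "b Z (lc U c Z) = b U Z + c * b Z Z"
    using lin[OF assms(3,4,4)] sym by metis
  finally show ?thesis using sym[of Z U] by (simp add: algebra_simps power2_eq_square)
qed

lemma hform_square:
  "U \<in> \<U> \<Longrightarrow> Z \<in> \<U> \<Longrightarrow> hform (lc U c Z) (lc U c Z) = hform U U + 2 * c * hform U Z + c\<^sup>2 * hform Z Z"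
  by (intro square_lincomb hform_lincomb hform_sym)

lemma normU2_lincomb:
  "U \<in> \<U> \<Longrightarrow> Z \<in> \<U> \<Longrightarrow> nU (lc U c Z) = nU U + 2 * c * iU U Z + c\<^sup>2 * nU Z"
  unfolding innerU_self[symmetric] by (intro square_lincomb innerU_lincomb innerU_sym)

lemma hform_Cauchy_Schwarz:
  assumes "U \<in> \<U>" "Z \<in> \<U>"
  shows "(hform U Z)\<^sup>2 \<le> hform U U * hform Z Z"
proof (rule quadratic_nonneg_discriminant)
  have nn: "0 \<le> hform Y Y" for Y using hform_ge[of Y] normU2_nonneg[of Y] by linarith
  show "0 \<le> hform U U + 2 * t * hform U Z + t\<^sup>2 * hform Z Z" for t
    using hform_square[OF assms, of t] nn[of "lc U t Z"] by simp
  show "0 \<le> hform Z Z" by (rule nn)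
qed

lemma innerU_Cauchy_Schwarz:
  assumes "U \<in> \<U>" "Z \<in> \<U>"
  shows "(iU U Z)\<^sup>2 \<le> nU U * nU Z"
proof (rule quadratic_nonneg_discriminant)
  show "0 \<le> nU U + 2 * t * iU U Z + t\<^sup>2 * nU Z" for t
    using normU2_lincomb[OF assms, of t] normU2_nonneg[of "lc U t Z"] by simp
qed (rule normU2_nonneg)

lemma L_norm_le:
  assumes "Z \<in> \<U>" "n \<le> N"
  shows "expectation (\<lambda>\<omega>. (norm (L Z n \<omega>))\<^sup>2) \<le> 2 * exp (2 * T) * nU Z"
proof -
  have "0 \<le> 2 * \<tau> * (\<Sum>i\<in>{1..n}. expectation (\<lambda>\<omega>. a (L Z i \<omega>) (L Z i \<omega>)))"
    using \<tau> assms(2)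
    by (intro mult_nonneg_nonneg sum_nonneg Bochner_Integration.integral_nonneg form_nonneg V_H
        sqint_V[OF L_sqint_M[OF assms(1)]]) auto
  then show ?thesis using L_energy[OF assms] by linarith
qed

text \<open>A crude bound that makes the set under the \<open>Sup\<close> in \<open>Kconst\<close>
  bounded; it also forces B(U, U) = 0 when U has norm zero. The factor T is the total weight of the
  N time steps and \<alpha> that of the terminal term.\<close>

lemma hform_le:
  assumes "U \<in> \<U>"
  shows "hform U U \<le> (1 + (T + \<alpha>) * (2 * exp (2 * T))) * nU U"
proof -
  define c where "c = 2 * exp (2 * T) * nU U"
  have le: "expectation (\<lambda>\<omega>. inner (L U n \<omega>) (L U n \<omega>)) \<le> c" if "n \<le> N" for n
    using L_norm_le[OF assms that] by (simp add: c_def power2_norm_eq_inner)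
  have "(\<Sum>n\<in>{1..N}. expectation (\<lambda>\<omega>. inner (L U n \<omega>) (L U n \<omega>))) \<le> real N * c"
    using sum_bounded_above[of "{1..N}" "\<lambda>n. expectation (\<lambda>\<omega>. inner (L U n \<omega>) (L U n \<omega>))" c] le by simp
  then have "iX (L U) (L U) \<le> \<tau> * (real N * c)"
    unfolding innerX_def using \<tau> by (intro mult_left_mono) auto
  also have "\<dots> = T * c" using N by simp
  finally have "obs (L U) (L U) \<le> T * c + \<alpha> * c"
    unfolding obs_def using le[of N] \<alpha> by (intro add_mono mult_left_mono) auto
  then show ?thesis by (simp add: hform_def innerU_self c_def algebra_simps)
qed

section \<open>The Hessian and its norm K\<close>

lemma Ladj:
  assumes "U \<in> \<U>"
  shows "Ladj M W V a T N (L U) \<in> \<U>"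
    "Z \<in> \<U> \<Longrightarrow> iX (L Z) (L U) = iU Z (Ladj M W V a T N (L U))"
proof -
  \<comment> \<open>The conditional expectation serves only as a witness. The term chosen by
    \<open>SOME\<close> may be another representer, so its defining property is all that is
    retained.\<close>
  have "\<exists>Y. Y \<in> \<U> \<and> (\<forall>Z\<in>\<U>. iX (L Z) (L U) = iU Z Y)"
    using adjX[of _ "L U"] adjX_Uspace[of "L U"] L_sqint_M[OF assms] by (intro exI[of _ "adjX (L U)"]) auto
  from someI_ex[OF this, folded Ladj_def]
  show "Ladj M W V a T N (L U) \<in> \<U>"
    "Z \<in> \<U> \<Longrightarrow> iX (L Z) (L U) = iU Z (Ladj M W V a T N (L U))"
    by auto
qed

lemma Lhat_adj:
  assumes "U \<in> \<U>"
  shows "Lhat_adj M W V a T N (L U N) \<in> \<U>"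
    "Z \<in> \<U> \<Longrightarrow> expectation (\<lambda>\<omega>. inner (L Z N \<omega>) (L U N \<omega>)) = iU Z (Lhat_adj M W V a T N (L U N))"
proof -
  have "\<exists>Y. Y \<in> \<U> \<and> (\<forall>Z\<in>\<U>. expectation (\<lambda>\<omega>. inner (L Z N \<omega>) (L U N \<omega>)) = iU Z Y)"
    using adjT[OF _ L_sqint_M[OF assms order_refl]] adjT_Uspace[OF L_sqint_M[OF assms order_refl]]
    by (intro exI[of _ "adjT (L U N)"]) auto
  from someI_ex[OF this, folded Lhat_adj_def]
  show "Lhat_adj M W V a T N (L U N) \<in> \<U>"
    "Z \<in> \<U> \<Longrightarrow> expectation (\<lambda>\<omega>. inner (L Z N \<omega>) (L U N \<omega>)) = iU Z (Lhat_adj M W V a T N (L U N))"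
    by auto
qed

lemma innerU_right_comb:
  assumes "Z \<in> \<U>" "U \<in> \<U>" "P \<in> \<U>" "Q \<in> \<U>"
  shows "(\<lambda>n \<omega>. U n \<omega> + P n \<omega> + c *\<^sub>R Q n \<omega>) \<in> \<U>"
    "iU Z (\<lambda>n \<omega>. U n \<omega> + P n \<omega> + c *\<^sub>R Q n \<omega>) = iU Z U + iU Z P + c * iU Z Q"
proof -
  have UP: "(\<lambda>n \<omega>. U n \<omega> + P n \<omega>) \<in> \<U>"
    using Uspace_lincomb[OF assms(2,3), of 1] by simp
  show "(\<lambda>n \<omega>. U n \<omega> + P n \<omega> + c *\<^sub>R Q n \<omega>) \<in> \<U>"
    by (rule Uspace_lincomb[OF UP assms(4)])
  show "iU Z (\<lambda>n \<omega>. U n \<omega> + P n \<omega> + c *\<^sub>R Q n \<omega>) = iU Z U + iU Z P + c * iU Z Q"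
    using innerU_lincomb[OF UP assms(4,1), of c] innerU_lincomb[OF assms(2,3,1), of 1]
    by (simp add: innerU_sym[of Z])
qed

lemma Hess:
  assumes U: "U \<in> \<U>"
  shows "Hess M W V a T N \<alpha> U \<in> \<U>" "Z \<in> \<U> \<Longrightarrow> iU Z (Hess M W V a T N \<alpha> U) = hform Z U"
proof -
  show "Hess M W V a T N \<alpha> U \<in> \<U>"
    unfolding Hess_def by (rule innerU_right_comb[OF U U Ladj(1)[OF U] Lhat_adj(1)[OF U]])
  assume Z: "Z \<in> \<U>"
  show "iU Z (Hess M W V a T N \<alpha> U) = hform Z U"
    unfolding Hess_def innerU_right_comb(2)[OF Z U Ladj(1)[OF U] Lhat_adj(1)[OF U]]
    by (simp add: hform_def obs_def Ladj(2)[OF U Z] Lhat_adj(2)[OF U Z])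
qed

text \<open>Cauchy-Schwarz for B gives |g|^4 = B(U, g)^2 \<le> B(U, U) B(g, g) \<le> c B(U, U)
  |g|^2, and one factor |g|^2 cancels. It is applied to the Hessian, to bound K, and to the
  gradient.\<close>

lemma representer_norm_le:
  assumes U: "U \<in> \<U>" and g: "g \<in> \<U>" and rep: "nU g = hform U g"
    and c: "\<And>Z. Z \<in> \<U> \<Longrightarrow> hform Z Z \<le> c * nU Z"
  shows "nU g \<le> c * hform U U"
proof (cases "nU g = 0")
  case True
  \<comment> \<open>The sign of c is not assumed. If c is negative, the bound at U forces B(U, U) =
    0.\<close>
  have "0 \<le> c * nU U"
    using c[OF U] hform_ge[of U] normU2_nonneg[of U] by linarith
  moreover have nn: "0 \<le> hform U U" using hform_ge[of U] normU2_nonneg[of U] by linarith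
  ultimately have "0 \<le> c * hform U U"
    using c[OF U] normU2_nonneg[of U] by (cases "c \<ge> 0") (auto simp: mult_le_0_iff zero_le_mult_iff)
  then show ?thesis using True by simp
next
  case False
  then have pos: "nU g > 0" using normU2_nonneg[of g] by simp
  have "nU g * nU g = (hform U g)\<^sup>2" by (simp add: rep power2_eq_square)
  also have "\<dots> \<le> hform U U * hform g g" by (rule hform_Cauchy_Schwarz[OF U g])
  also have "\<dots> \<le> hform U U * (c * nU g)"
    using c[OF g] hform_ge[of U] normU2_nonneg[of U] by (intro mult_left_mono) auto
  finally have "nU g * nU g \<le> (c * hform U U) * nU g" by (simp add: mult_ac)
  then show ?thesis using pos by (simp only: mult_le_cancel_right_pos)
qed

text \<open>For a unit vector Y, B(Y, Y) is the inner product of Y with its Hessian image, hence at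
  most the norm of that image and at most K. A general U is rescaled, and norm zero is handled by
  the crude bound.\<close>

lemma hform_le_Kconst:
  assumes U: "U \<in> \<U>"
  shows "hform U U \<le> Kconst M W V a T N \<alpha> * nU U"
proof (cases "nU U = 0")
  case True
  then show ?thesis using hform_le[OF U] by simp
next
  case False
  define c where "c = 1 + (T + \<alpha>) * (2 * exp (2 * T))"
  define S where "S = {sqrt (nU (Hess M W V a T N \<alpha> U)) | U. U \<in> \<U> \<and> nU U \<le> 1}"
  have c: "c \<ge> 0" using T \<alpha> by (simp add: c_def)
  have bdd: "bdd_above S"
  proof (rule bdd_aboveI[of _ c])
    fix x assume "x \<in> S"
    then obtain Z where Z: "Z \<in> \<U>" "nU Z \<le> 1" and x: "x = sqrt (nU (Hess M W V a T N \<alpha> Z))"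
      unfolding S_def by blast
    let ?g = "Hess M W V a T N \<alpha> Z"
    have "nU ?g = hform Z ?g"
      using Hess[OF Z(1)] by (simp add: innerU_self[symmetric] hform_sym[of Z])
    then have "nU ?g \<le> c * hform Z Z"
      using hform_le by (intro representer_norm_le Hess Z) (auto simp: c_def)
    also have "\<dots> \<le> c * (c * nU Z)"
      using hform_le[OF Z(1)] c by (intro mult_left_mono) (auto simp: c_def)
    also have "\<dots> \<le> c * (c * 1)"
      using c Z(2) by (intro mult_left_mono) auto
    finally have "x \<le> sqrt (c\<^sup>2)"
      unfolding x by (intro real_sqrt_le_mono) (simp add: power2_eq_square)
    then show "x \<le> c" using c by simp
  qed
  have pos: "nU U > 0" using False normU2_nonneg[of U] by simp
  define s where "s = 1 / sqrt (nU U)"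
  have s2: "s\<^sup>2 * nU U = 1" using pos by (simp add: s_def power_divide)
  \<comment> \<open>This is s times U, written as a combination of U with itself so that the
    expansion lemmas apply.\<close>
  define Y where "Y = lc U (s - 1) U"
  have Y: "Y \<in> \<U>" unfolding Y_def using U U by (rule Uspace_lincomb)
  have nY: "nU Y = 1"
    unfolding Y_def normU2_lincomb[OF U U] using s2 by (simp add: innerU_self power2_eq_square algebra_simps)
  have hY: "hform Y Y = s\<^sup>2 * hform U U"
    unfolding Y_def hform_square[OF U U] by (simp add: power2_eq_square algebra_simps)
  have "hform Y Y = iU Y (Hess M W V a T N \<alpha> Y)" using Hess(2)[OF Y Y] by simp
  also have "\<dots> \<le> sqrt ((iU Y (Hess M W V a T N \<alpha> Y))\<^sup>2)" by simp
  also have "\<dots> \<le> sqrt (nU Y * nU (Hess M W V a T N \<alpha> Y))"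
    by (intro real_sqrt_le_mono innerU_Cauchy_Schwarz Y Hess)
  also have "\<dots> = sqrt (nU (Hess M W V a T N \<alpha> Y))" by (simp add: nY)
  also have "\<dots> \<le> Sup S"
    by (rule cSup_upper[OF _ bdd]) (use Y nY in \<open>auto simp: S_def\<close>)
  also have "Sup S = Kconst M W V a T N \<alpha>" by (simp add: Kconst_def S_def)
  finally have "s\<^sup>2 * hform U U \<le> Kconst M W V a T N \<alpha>" by (simp add: hY)
  then have "s\<^sup>2 * hform U U * nU U \<le> Kconst M W V a T N \<alpha> * nU U"
    using pos by (intro mult_right_mono) auto
  also have "s\<^sup>2 * hform U U * nU U = hform U U"
    using s2 by (metis mult.assoc mult.commute mult_1_right)
  finally show ?thesis .
qed

definition grad :: "(nat \<Rightarrow> 'w \<Rightarrow> 'a) \<Rightarrow> nat \<Rightarrow> 'w \<Rightarrow> 'a" where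
  "grad U n \<omega> = U n \<omega> - Yadj M W V a T N \<alpha> (St U) n \<omega>"

lemma grad:
  assumes U: "U \<in> \<U>"
  shows "grad U \<in> \<U>" "Z \<in> \<U> \<Longrightarrow> iU Z (grad U) = dJ U Z"
proof -
  have eq: "grad U = (\<lambda>n \<omega>. U n \<omega> + adjX (St U) n \<omega> + \<alpha> *\<^sub>R adjT (St U N) n \<omega>)"
    by (intro ext) (simp add: grad_def Yadj_eq)
  have X: "\<And>j. j \<in> {1..N} \<Longrightarrow> sqint M (St U j)" and XN: "sqint M (St U N)"
    using St_sqint_M[OF U] by auto
  have P: "adjX (St U) \<in> \<U>" using X by (rule adjX_Uspace)
  have Q: "adjT (St U N) \<in> \<U>" using XN by (rule adjT_Uspace)
  show "grad U \<in> \<U>"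
    unfolding eq by (rule innerU_right_comb[OF U U P Q])
  assume Z: "Z \<in> \<U>"
  have "iX (L Z) (St U) = iU Z (adjX (St U))" using Z X by (rule adjX)
  then have "iU Z (grad U) = iU U Z + (iX (L Z) (St U) + \<alpha> * expectation (\<lambda>\<omega>. inner (L Z N \<omega>) (St U N \<omega>)))"
    unfolding eq innerU_right_comb(2)[OF Z U P Q] adjT[OF Z XN] by (simp add: innerU_sym[of Z U])
  then show "iU Z (grad U) = dJ U Z"
    unfolding obs_def[symmetric] obs_sym[of "L Z"] by (simp add: dJ_def)
qed

section \<open>Expansion of the reduced cost and the first-order condition\<close>

abbreviation "J \<equiv> Jhat M W V a T N \<alpha> X0 \<sigma>"

lemma J_eq: "J U = (1 / 2) * (iU U U + obs (St U) (St U))"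
  by (simp add: Jhat_def Jcost_def normX2_def obs_def innerX_def innerU_self power2_norm_eq_inner algebra_simps)

text \<open>A Taylor formula without remainder, because the state is affine and the cost
  quadratic.\<close>

lemma J_lincomb:
  assumes "U \<in> \<U>" "Z \<in> \<U>"
  shows "J (lc U t Z) = J U + t * dJ U Z + (t\<^sup>2 / 2) * hform Z Z"
proof -
  have S: "\<And>n. n \<le> N \<Longrightarrow> sqint M (St U n)" and LZ: "\<And>n. n \<le> N \<Longrightarrow> sqint M (L Z n)"
    and S': "\<And>n. n \<le> N \<Longrightarrow> sqint M (St (lc U t Z) n)"
    using assms by (auto intro: St_sqint_M L_sqint_M Uspace_lincomb)
  note lin = St_lincomb[OF assms, of _ _ t]
  have "obs (St (lc U t Z)) (St (lc U t Z)) = obs (St U) (St (lc U t Z)) + t * obs (L Z) (St (lc U t Z))"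
    by (intro obs_lincomb S LZ S' lin)
  also have "obs (St U) (St (lc U t Z)) = obs (St U) (St U) + t * obs (L Z) (St U)"
    by (subst obs_sym, intro obs_lincomb S LZ lin)
  also have "obs (L Z) (St (lc U t Z)) = obs (St U) (L Z) + t * obs (L Z) (L Z)"
    by (subst obs_sym, intro obs_lincomb S LZ lin)
  finally have o: "obs (St (lc U t Z)) (St (lc U t Z)) =
      obs (St U) (St U) + 2 * t * obs (St U) (L Z) + t\<^sup>2 * obs (L Z) (L Z)"
    by (simp add: obs_sym[of "L Z" "St U"] power2_eq_square algebra_simps)
  show ?thesis
    unfolding J_eq o using normU2_lincomb[OF assms, of t]
    by (simp add: innerU_self dJ_def hform_def field_simps)
qed

text \<open>At a minimiser, t dJ + t^2 B(Z, Z) / 2 is nonnegative for every real t. This quadratic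
  has constant term 0, so the discriminant inequality forces its linear coefficient to
  vanish.\<close>

lemma optimal_dJ:
  assumes opt: "optimal_control M W V a T N \<alpha> X0 \<sigma> U" and Z: "Z \<in> \<U>"
  shows "dJ U Z = 0"
proof -
  have U: "U \<in> \<U>" and min: "\<And>Y. Y \<in> \<U> \<Longrightarrow> J U \<le> J Y"
    using opt by (auto simp: optimal_control_def)
  have "(dJ U Z / 2)\<^sup>2 \<le> 0 * (hform Z Z / 2)"
  proof (rule quadratic_nonneg_discriminant)
    show "0 \<le> 0 + 2 * t * (dJ U Z / 2) + t\<^sup>2 * (hform Z Z / 2)" for t
      using min[OF Uspace_lincomb[OF U Z, of t]] J_lincomb[OF U Z, of t] by simp
    show "0 \<le> hform Z Z / 2" using hform_ge[of Z] normU2_nonneg[of Z] by simp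
  qed
  then show ?thesis by simp
qed

section \<open>The iterates and their rates of convergence\<close>

context
  fixes \<kappa> :: real and U0 Uopt
  assumes \<kappa>: "\<kappa> \<ge> Kconst M W V a T N \<alpha>" and U0: "U0 \<in> \<U>"
    and opt: "optimal_control M W V a T N \<alpha> X0 \<sigma> Uopt"
begin

abbreviation "Ul \<equiv> gd_iter M W V a T N \<alpha> X0 \<sigma> \<kappa> U0"

definition err :: "nat \<Rightarrow> nat \<Rightarrow> 'w \<Rightarrow> 'a" where
  "err l = (\<lambda>n \<omega>. Ul l n \<omega> - Uopt n \<omega>)"

lemma Uopt: "Uopt \<in> \<U>"
  using opt by (simp add: optimal_control_def)

lemma Ul_Suc: "Ul (Suc l) = lc (Ul l) (- (1 / \<kappa>)) (grad (Ul l))"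
  by (intro ext) (simp add: grad_def)

lemma Ul_Uspace: "Ul l \<in> \<U>"
proof (induction l)
  case (Suc l)
  show ?case unfolding Ul_Suc by (rule Uspace_lincomb[OF Suc grad(1)[OF Suc]])
qed (simp add: U0)

lemma err_Uspace: "err l \<in> \<U>"
  using Uspace_lincomb[OF Ul_Uspace[of l] Uopt, of "- 1"] by (simp add: err_def)

lemma Ul_err: "Ul l = lc Uopt 1 (err l)"
  by (simp add: err_def)

lemma err_Suc: "err (Suc l) = lc (err l) (- (1 / \<kappa>)) (grad (Ul l))"
  unfolding err_def Ul_Suc by (simp add: algebra_simps)

lemma dJ_Ul: "Z \<in> \<U> \<Longrightarrow> dJ (Ul l) Z = hform (err l) Z"
  using dJ_lincomb[OF Uopt err_Uspace[of l], of Z 1] optimal_dJ[OF opt] Ul_err[of l] by simp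

lemma J_Ul: "J (Ul l) - J Uopt = hform (err l) (err l) / 2"
  using J_lincomb[OF Uopt err_Uspace[of l], of 1] optimal_dJ[OF opt err_Uspace[of l]] Ul_err[of l] by simp

lemma hform_le_\<kappa>: "Z \<in> \<U> \<Longrightarrow> hform Z Z \<le> \<kappa> * nU Z"
  using hform_le_Kconst[of Z] mult_right_mono[OF \<kappa> normU2_nonneg[of Z]] by linarith

text \<open>The same step is expanded in two quadratic forms. In the norm the cross term is (d, g) =
  B(d, d), in B it is B(d, g) = |g|^2. Each time the quadratic term consumes at most half of the
  decrease, by |g|^2 \<le> \<kappa> B(d, d) and by B(g, g) \<le> \<kappa> |g|^2
  respectively.\<close>

lemma descent_step:
  assumes "\<kappa> \<ge> 1"
  shows "nU (err (Suc l)) \<le> nU (err l) - hform (err l) (err l) / \<kappa>"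
    and "hform (err (Suc l)) (err (Suc l)) \<le> hform (err l) (err l)"
proof -
  define g where "g = grad (Ul l)"
  have g: "g \<in> \<U>" unfolding g_def by (rule grad(1)[OF Ul_Uspace])
  have rep: "iU Z g = hform (err l) Z" if "Z \<in> \<U>" for Z
    unfolding g_def using grad(2)[OF Ul_Uspace that] dJ_Ul[OF that] by simp
  have q: "nU g = hform (err l) g" using rep[OF g] by (simp add: innerU_self)
  have q_le: "nU g \<le> \<kappa> * hform (err l) (err l)"
    by (rule representer_norm_le[OF err_Uspace g q hform_le_\<kappa>])
  have r_le: "hform g g \<le> \<kappa> * nU g" by (rule hform_le_\<kappa>[OF g])
  have "nU (err (Suc l)) = nU (err l) - 2 * (hform (err l) (err l) / \<kappa>) + nU g / \<kappa> / \<kappa>"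
    unfolding err_Suc g_def[symmetric] normU2_lincomb[OF err_Uspace g] rep[OF err_Uspace]
    by (simp add: power2_eq_square)
  moreover have "nU g / \<kappa> / \<kappa> \<le> hform (err l) (err l) / \<kappa>"
    using q_le assms by (intro divide_right_mono) (auto simp: pos_divide_le_eq mult.commute)
  ultimately show "nU (err (Suc l)) \<le> nU (err l) - hform (err l) (err l) / \<kappa>" by linarith
  have "hform (err (Suc l)) (err (Suc l)) = hform (err l) (err l) - 2 * (nU g / \<kappa>) + hform g g / \<kappa> / \<kappa>"
    unfolding err_Suc g_def[symmetric] hform_square[OF err_Uspace g] q[symmetric]
    by (simp add: power2_eq_square)
  moreover have "hform g g / \<kappa> / \<kappa> \<le> nU g / \<kappa>"
    using r_le assms by (intro divide_right_mono) (auto simp: pos_divide_le_eq mult.commute)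
  moreover have "0 \<le> nU g / \<kappa>" using normU2_nonneg[of g] assms by simp
  ultimately show "hform (err (Suc l)) (err (Suc l)) \<le> hform (err l) (err l)" by linarith
qed

text \<open>This case occurs only for \<open>V = {0}\<close>, where \<open>K = 0\<close>.\<close>
lemma normU2_degenerate: "\<kappa> < 1 \<Longrightarrow> Z \<in> \<U> \<Longrightarrow> nU Z = 0"
proof -
  assume "\<kappa> < 1" "Z \<in> \<U>"
  then have "(1 - \<kappa>) * nU Z \<le> 0"
    using hform_le_\<kappa>[of Z] hform_ge[of Z] by (simp add: left_diff_distrib)
  then show "nU Z = 0"
    using \<open>\<kappa> < 1\<close> normU2_nonneg[of Z] by (simp add: mult_le_0_iff)
qed

lemma control_rate: "nU (err l) \<le> (1 - 1 / \<kappa>) ^ l * nU (err 0)"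
proof (cases "\<kappa> \<ge> 1")
  case True
  show ?thesis
    by (rule gradient_descent_rates(1)[where E = "\<lambda>l. nU (err l)" and P = "\<lambda>l. hform (err l) (err l)", OF True normU2_nonneg hform_ge descent_step[OF True]])
qed (simp add: normU2_degenerate err_Uspace)

lemma cost_rate:
  assumes "l \<ge> 1"
  shows "J (Ul l) - J Uopt \<le> 2 * \<kappa> * nU (err 0) / real l"
proof (cases "\<kappa> \<ge> 1")
  case True
  have le: "real l * hform (err l) (err l) \<le> \<kappa> * nU (err 0)"
    by (rule gradient_descent_rates(2)[where E = "\<lambda>l. nU (err l)" and P = "\<lambda>l. hform (err l) (err l)", OF True normU2_nonneg hform_ge descent_step[OF True]])
  have "0 \<le> \<kappa> * nU (err 0)" using True normU2_nonneg[of "err 0"] by simp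
  \<comment> \<open>The cost gap is half of B(d, d), so the argument gives the factor \<kappa> / 2,
    which is relaxed to 2 \<kappa>.\<close>
  then have "real l * (hform (err l) (err l) / 2) \<le> 2 * \<kappa> * nU (err 0)" using le by simp
  then show ?thesis
    unfolding J_Ul using assms by (simp add: pos_le_divide_eq mult.commute)
next
  case False
  then have "nU (err l) = 0" "nU (err 0) = 0" by (simp_all add: normU2_degenerate err_Uspace)
  then show ?thesis
    unfolding J_Ul using hform_le[OF err_Uspace[of l]] by simp
qed

text \<open>The state error is, up to sign, L applied to the control error. The energy bound
  \<open>2 * exp (2 * T)\<close> is used once at each n for the maximum and once at N for the
  gradient sum; there the sum carries weight \<open>2 * \<tau>\<close>, so it contributes half as
  much and the total factor is 3.\<close>

lemma state_rate:
  "Max ((\<lambda>n. expectation (\<lambda>\<omega>. (norm (St Uopt n \<omega> - St (Ul l) n \<omega>))\<^sup>2)) ` {0..N})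
    + \<tau> * (\<Sum>n\<in>{1..N}. expectation (\<lambda>\<omega>. a (St Uopt n \<omega> - St (Ul l) n \<omega>) (St Uopt n \<omega> - St (Ul l) n \<omega>)))
    \<le> 3 * exp (2 * T) * (1 - 1 / \<kappa>) ^ l * nU (err 0)"
proof -
  define e where "e = (\<Sum>n\<in>{1..N}. expectation (\<lambda>\<omega>. a (L (err l) n \<omega>) (L (err l) n \<omega>)))"
  have diff: "St Uopt n \<omega> - St (Ul l) n \<omega> = (- 1) *\<^sub>R L (err l) n \<omega>" if "\<omega> \<in> space M" "n \<le> N" for n \<omega>
    using St_lincomb[OF Uopt err_Uspace[of l] that, of 1] Ul_err[of l] by simp
  have x: "expectation (\<lambda>\<omega>. (norm (St Uopt n \<omega> - St (Ul l) n \<omega>))\<^sup>2) = expectation (\<lambda>\<omega>. (norm (L (err l) n \<omega>))\<^sup>2)"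
    if "n \<le> N" for n
    using that by (intro Bochner_Integration.integral_cong refl) (simp only: diff norm_scaleR, simp)
  have "a (c *\<^sub>R y) (c *\<^sub>R y) = c * (c * a y y)" if "y \<in> V" for c y
    using that form_sym[of y "c *\<^sub>R y"] by (simp add: form_scale)
  from this[of _ "- 1"] have a: "a ((- 1) *\<^sub>R y) ((- 1) *\<^sub>R y) = a y y" if "y \<in> V" for y
    using that by simp
  have e: "(\<Sum>n\<in>{1..N}. expectation (\<lambda>\<omega>. a (St Uopt n \<omega> - St (Ul l) n \<omega>) (St Uopt n \<omega> - St (Ul l) n \<omega>))) = e"
    unfolding e_def
  proof (intro sum.cong refl Bochner_Integration.integral_cong)
    fix n \<omega> assume "n \<in> {1..N}" and w: "\<omega> \<in> space M"
    then have n: "n \<le> N" by simp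
    show "a (St Uopt n \<omega> - St (Ul l) n \<omega>) (St Uopt n \<omega> - St (Ul l) n \<omega>) = a (L (err l) n \<omega>) (L (err l) n \<omega>)"
      unfolding diff[OF w n] by (rule a[OF sqint_V[OF L_sqint_M[OF err_Uspace n] w]])
  qed
  have "Max ((\<lambda>n. expectation (\<lambda>\<omega>. (norm (St Uopt n \<omega> - St (Ul l) n \<omega>))\<^sup>2)) ` {0..N}) \<le> 2 * exp (2 * T) * nU (err l)"
    using x L_norm_le[OF err_Uspace[of l]] by (intro Max.boundedI) auto
  moreover have "2 * (\<tau> * e) \<le> 2 * (exp (2 * T) * nU (err l))"
  proof -
    have "0 \<le> expectation (\<lambda>\<omega>. (norm (L (err l) N \<omega>))\<^sup>2)" by simp
    then show ?thesis
      using L_energy[OF err_Uspace[of l] order_refl] unfolding e_def[symmetric] mult.assoc by linarith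
  qed
  ultimately have "Max ((\<lambda>n. expectation (\<lambda>\<omega>. (norm (St Uopt n \<omega> - St (Ul l) n \<omega>))\<^sup>2)) ` {0..N}) + \<tau> * e
      \<le> 3 * (exp (2 * T) * nU (err l))" by linarith
  also have "\<dots> \<le> 3 * (exp (2 * T) * ((1 - 1 / \<kappa>) ^ l * nU (err 0)))"
    using control_rate by (intro mult_left_mono) auto
  finally show ?thesis unfolding e by (simp only: mult.assoc)
qed

end

end

text \<open>Independence of C from the mesh, the step and the iteration is expressed by quantifier
  order: C is chosen before V, N, \<kappa>, the controls and l. The mesh size enters only through V,
  and the witness depends on T alone.\<close>

theorem theorem4p1:
  fixes M :: "'w measure" and W :: "real \<Rightarrow> 'w \<Rightarrow> real"
    and H :: "'a::{real_inner, banach, second_countable_topology} set" and a :: "'a \<Rightarrow> 'a \<Rightarrow> real"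
    and T \<alpha> :: real and X0 :: 'a and \<sigma> :: "real \<Rightarrow> 'a"
  assumes "prob_space M" and "wiener_process M W"
    and "dirichlet_form H a"
    and "T > 0" and "\<alpha> \<ge> 0"
    and "X0 \<in> H" and "\<forall>t\<in>{0..T}. \<sigma> t \<in> H"
  shows "\<exists>C. \<forall>V N \<kappa> U0 Uopt. fe_space H V \<and> N > 0 \<and> T / real N \<le> 1
      \<and> \<kappa> \<ge> Kconst M W V a T N \<alpha>
      \<and> U0 \<in> Uspace M W T V N
      \<and> optimal_control M W V a T N \<alpha> X0 \<sigma> Uopt \<longrightarrow>
      (\<forall>l::nat. l \<ge> 1 \<longrightarrow>
        (let Ul = gd_iter M W V a T N \<alpha> X0 \<sigma> \<kappa> U0 l;
             Xl = state W V a T N X0 \<sigma> Ul;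
             Xopt = state W V a T N X0 \<sigma> Uopt;
             e0 = normU2 M T N (\<lambda>n \<omega>. U0 n \<omega> - Uopt n \<omega>)
         in normU2 M T N (\<lambda>n \<omega>. Ul n \<omega> - Uopt n \<omega>) \<le> (1 - 1 / \<kappa>) ^ l * e0
          \<and> Jhat M W V a T N \<alpha> X0 \<sigma> Ul - Jhat M W V a T N \<alpha> X0 \<sigma> Uopt \<le> 2 * \<kappa> * e0 / real l
          \<and> Max ((\<lambda>n. integral\<^sup>L M (\<lambda>\<omega>. (norm (Xopt n \<omega> - Xl n \<omega>))\<^sup>2)) ` {0..N})
            + (T / real N) * (\<Sum>n\<in>{1..N}. integral\<^sup>L M (\<lambda>\<omega>. a (Xopt n \<omega> - Xl n \<omega>) (Xopt n \<omega> - Xl n \<omega>)))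
            \<le> C * (1 - 1 / \<kappa>) ^ l * e0))"
proof (intro exI[of _ "3 * exp (2 * T)"] allI impI)
  fix V :: "'a set" and N :: nat and \<kappa> :: real and U0 Uopt :: "nat \<Rightarrow> 'w \<Rightarrow> 'a" and l :: nat
  assume asm: "fe_space H V \<and> N > 0 \<and> T / real N \<le> 1 \<and> \<kappa> \<ge> Kconst M W V a T N \<alpha>
      \<and> U0 \<in> Uspace M W T V N \<and> optimal_control M W V a T N \<alpha> X0 \<sigma> Uopt" and l: "l \<ge> 1"
  interpret prob_space M by fact
  interpret slq H V a M W T \<alpha> N X0 \<sigma>
    using assms asm by unfold_locales auto
  have asm': "\<kappa> \<ge> Kconst M W V a T N \<alpha>" "U0 \<in> Uspace M W T V N" "optimal_control M W V a T N \<alpha> X0 \<sigma> Uopt"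
    using asm by auto
  note err = err_def[OF asm']
  show "let Ul = gd_iter M W V a T N \<alpha> X0 \<sigma> \<kappa> U0 l;
             Xl = state W V a T N X0 \<sigma> Ul;
             Xopt = state W V a T N X0 \<sigma> Uopt;
             e0 = normU2 M T N (\<lambda>n \<omega>. U0 n \<omega> - Uopt n \<omega>)
         in normU2 M T N (\<lambda>n \<omega>. Ul n \<omega> - Uopt n \<omega>) \<le> (1 - 1 / \<kappa>) ^ l * e0
          \<and> Jhat M W V a T N \<alpha> X0 \<sigma> Ul - Jhat M W V a T N \<alpha> X0 \<sigma> Uopt \<le> 2 * \<kappa> * e0 / real l
          \<and> Max ((\<lambda>n. integral\<^sup>L M (\<lambda>\<omega>. (norm (Xopt n \<omega> - Xl n \<omega>))\<^sup>2)) ` {0..N})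
            + (T / real N) * (\<Sum>n\<in>{1..N}. integral\<^sup>L M (\<lambda>\<omega>. a (Xopt n \<omega> - Xl n \<omega>) (Xopt n \<omega> - Xl n \<omega>)))
            \<le> 3 * exp (2 * T) * (1 - 1 / \<kappa>) ^ l * e0"
    using control_rate[OF asm', of l] cost_rate[OF asm' l] state_rate[OF asm', of l]
    unfolding Let_def err by simp
qed

end
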